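(* Let ${}_A X_A$ and ${}_B Y_B$ be C*-correspondences. Then ${}_A X_A$ and ${}_B Y_B$ are completely isometrically isomorphic as operator bimodules if and only if ${}_A X_A$ and ${}_B Y_B$ are unitarily equivalent as C*-correspondences.
   Context: A C*-correspondence ${}_A X_A$ is a right Hilbert $A$-module $X$ with a $*$-homomorphism $\phi_X\colon A\to\mathcal{L}(X)$. Operator bimodule structure. The augmented linking algebra of $X$ is the C*-algebra $\begin{bmatrix} A & X^* \\ X & \mathcal{L}(X)\end{bmatrix}$ of adjointable operators on the Hilbert module $A\oplus X$, where $X^*=\mathcal{K}(X,A)$. The operator space structure on $X$ is the one it inherits as the $(2,1)$-corner of this C*-algebra; the right action of $A$ is multiplication by the $(1,1)$-corner, and the left action of $a\in A$ is multiplication by $\phi_X(a)$ in the $(2,2)$-corner. This makes $X$ an operator $A$-$A$-bimodule. Isomorphisms. ${}_A X_A$ and ${}_B Y_B$ are completely isometric as operator bimodules if there are a $*$-isomorphism $\gamma\colon A\to B$ and a surjective linear complete isometry $u\colon X\to Y$ with $u(\phi_X(a)x a')=\phi_Y(\gamma(a))u(x)\gamma(a')$ for all $a,a'\in A$, $x\in X$. They are unitarily equivalent as C*-correspondences if there are a $*$-isomorphism $\gamma\colon A\to B$ and a surjective linear map $u\colon X\to Y$ with the same bimodule property and $\langle u(x),u(x')\rangle_Y=\gamma(\langle x,x'\rangle_X)$ for all $x,x'\in X$.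
   Formalization: For operator bimodules, u is required to respect the left and the right action separately, not only the combined identity u(φ_X(a)xa') = φ_Y(γ(a))u(x)γ(a'); with the latter alone the claim fails for degenerate left actions (e.g. φ_X = φ_Y = 0 on c_0). *)

theory Defs
  imports "HOL-Analysis.Analysis"
begin

section \<open>C*-algebras\<close>

text \<open>
  Neither a unit nor \<open>0 \<noteq> 1\<close> is assumed, hence \<^class>\<open>real_normed_algebra\<close> rather
  than \<^class>\<open>real_normed_algebra_1\<close>; completeness is in \<^class>\<open>banach\<close>.
\<close>

class cstar_algebra = real_normed_algebra + banach +
  fixes scaleC :: "complex \<Rightarrow> 'a \<Rightarrow> 'a"  (infixr "*\<^sub>C" 75)
    and star :: "'a \<Rightarrow> 'a"
  assumes scaleC_of_real: "complex_of_real r *\<^sub>C x = r *\<^sub>R x"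
    and scaleC_add_right: "c *\<^sub>C (x + y) = c *\<^sub>C x + c *\<^sub>C y"
    and scaleC_add_left: "(c + d) *\<^sub>C x = c *\<^sub>C x + d *\<^sub>C x"
    and scaleC_scaleC: "c *\<^sub>C d *\<^sub>C x = (c * d) *\<^sub>C x"
    and mult_scaleC_left: "(c *\<^sub>C x) * y = c *\<^sub>C (x * y)"
    and mult_scaleC_right: "x * (c *\<^sub>C y) = c *\<^sub>C (x * y)"
    and norm_scaleC: "norm (c *\<^sub>C x) = cmod c * norm x"
    and star_star: "star (star x) = x"
    and star_add: "star (x + y) = star x + star y"
    and star_scaleC: "star (c *\<^sub>C x) = cnj c *\<^sub>C star x"
    and star_mult: "star (x * y) = star y * star x"
    and cstar_identity: "norm (star x * x) = (norm x)\<^sup>2"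

lemma vector_space_scaleC: "vector_space (scaleC :: complex \<Rightarrow> 'a::cstar_algebra \<Rightarrow> 'a)"
proof
  show "1 *\<^sub>C x = x" for x :: 'a
    using scaleC_of_real[of 1 x] by simp
qed (simp_all add: scaleC_add_right scaleC_add_left scaleC_scaleC)

definition star_isomorphism :: "('a::cstar_algebra \<Rightarrow> 'b::cstar_algebra) \<Rightarrow> bool" where
  "star_isomorphism \<gamma> \<longleftrightarrow>
     Vector_Spaces.linear scaleC scaleC \<gamma> \<and>
     (\<forall>a b. \<gamma> (a * b) = \<gamma> a * \<gamma> b) \<and>
     (\<forall>a. \<gamma> (star a) = star (\<gamma> a)) \<and>
     bij \<gamma>"


section \<open>Hilbert modules and C*-correspondences\<close>

record ('a, 'x) hilbert_mod =
  hscale :: "complex \<Rightarrow> 'x \<Rightarrow> 'x"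
  ract :: "'x \<Rightarrow> 'a \<Rightarrow> 'x"
  ip :: "'x \<Rightarrow> 'x \<Rightarrow> 'a"

definition hnorm :: "('a::cstar_algebra, 'x, 'm) hilbert_mod_scheme \<Rightarrow> 'x \<Rightarrow> real" where
  "hnorm E x = sqrt (norm (ip E x x))"

text \<open>
  Right Hilbert modules; the inner product is linear in the second variable. An element of a
  C*-algebra is positive iff it has the form \<open>star b * b\<close>.
\<close>

locale hilbert_module =
  fixes E :: "('a::cstar_algebra, 'x::ab_group_add, 'm) hilbert_mod_scheme"
  assumes vector_space_hscale: "vector_space (hscale E)"
    and ract_add_left: "ract E (x + y) a = ract E x a + ract E y a"
    and ract_add_right: "ract E x (a + b) = ract E x a + ract E x b"
    and ract_mult: "ract E x (a * b) = ract E (ract E x a) b"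
    and ract_hscale: "ract E (hscale E c x) a = hscale E c (ract E x a)"
    and ract_scaleC: "ract E x (c *\<^sub>C a) = hscale E c (ract E x a)"
    and ip_add_right: "ip E x (y + z) = ip E x y + ip E x z"
    and ip_hscale_right: "ip E x (hscale E c y) = c *\<^sub>C ip E x y"
    and ip_ract_right: "ip E x (ract E y a) = ip E x y * a"
    and star_ip: "star (ip E x y) = ip E y x"
    and ip_positive: "\<exists>b. ip E x x = star b * b"
    and ip_definite: "ip E x x = 0 \<Longrightarrow> x = 0"
    and complete:
      "(\<forall>e>0. \<exists>N. \<forall>m\<ge>N. \<forall>n\<ge>N. hnorm E (s m - s n) < e) \<Longrightarrow>
       \<exists>l. (\<lambda>n. hnorm E (s n - l)) \<longlonglongrightarrow> 0"

definition adjoint_pair ::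
    "('a, 'x, 'm) hilbert_mod_scheme \<Rightarrow> ('x \<Rightarrow> 'x) \<Rightarrow> ('x \<Rightarrow> 'x) \<Rightarrow> bool" where
  "adjoint_pair E T S \<longleftrightarrow> (\<forall>x y. ip E (T x) y = ip E x (S y))"

definition adjointable :: "('a, 'x, 'm) hilbert_mod_scheme \<Rightarrow> ('x \<Rightarrow> 'x) \<Rightarrow> bool" where
  "adjointable E T \<longleftrightarrow> (\<exists>S. adjoint_pair E T S)"

record ('a, 'x) corr = "('a, 'x) hilbert_mod" +
  lact :: "'a \<Rightarrow> 'x \<Rightarrow> 'x"

text \<open>
  The map \<^term>\<open>lact X\<close> is the *-homomorphism from the algebra to the adjointable operators; it
  need not be injective or nondegenerate, and the module need not be full.
\<close>

locale cstar_correspondence = hilbert_module X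
  for X :: "('a::cstar_algebra, 'x::ab_group_add) corr" +
  assumes lact_adjointable: "adjointable X (lact X a)"
    and lact_add: "lact X (a + b) x = lact X a x + lact X b x"
    and lact_scaleC: "lact X (c *\<^sub>C a) x = hscale X c (lact X a x)"
    and lact_mult: "lact X (a * b) x = lact X a (lact X b x)"
    and lact_star: "adjoint_pair X (lact X a) (lact X (star a))"


section \<open>The augmented linking algebra\<close>

definition sum_module ::
    "('a::cstar_algebra, 'x::ab_group_add, 'm) hilbert_mod_scheme \<Rightarrow> ('a, 'a \<times> 'x) hilbert_mod" where
  "sum_module E =
     \<lparr>hscale = (\<lambda>c (a, x). (c *\<^sub>C a, hscale E c x)),
      ract = (\<lambda>(a, x) b. (a * b, ract E x b)),
      ip = (\<lambda>(a, x) (b, y). star a * b + ip E x y)\<rparr>"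

text \<open>
  The operator norm closure of the span of the rank one operators \<open>y \<mapsto> a * ip x y\<close>.
\<close>

definition compact_functional ::
    "('a::cstar_algebra, 'x::ab_group_add, 'm) hilbert_mod_scheme \<Rightarrow> ('x \<Rightarrow> 'a) \<Rightarrow> bool" where
  "compact_functional E f \<longleftrightarrow>
     (\<forall>e>0. \<exists>(n::nat) a z. \<forall>y. norm (f y - (\<Sum>i<n. a i * ip E (z i) y)) \<le> e * hnorm E y)"

text \<open>
  The operator matrix with rows \<open>(a, f)\<close> and \<open>(x, T)\<close>, where \<open>a\<close> acts by left multiplication
  and \<open>x\<close> by \<open>b \<mapsto> x b\<close>.
\<close>

definition linking_op ::
    "('a::cstar_algebra, 'x::ab_group_add, 'm) hilbert_mod_scheme \<Rightarrow>
     'a \<Rightarrow> ('x \<Rightarrow> 'a) \<Rightarrow> 'x \<Rightarrow> ('x \<Rightarrow> 'x) \<Rightarrow> 'a \<times> 'x \<Rightarrow> 'a \<times> 'x" where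
  "linking_op E a f x T = (\<lambda>(b, y). (a * b + f y, ract E x b + T y))"

definition linking_algebra ::
    "('a::cstar_algebra, 'x::ab_group_add, 'm) hilbert_mod_scheme \<Rightarrow> ('a \<times> 'x \<Rightarrow> 'a \<times> 'x) set" where
  "linking_algebra E =
     {linking_op E a f x T | a f x T. compact_functional E f \<and> adjointable E T}"

definition corner ::
    "('a::cstar_algebra, 'x::ab_group_add, 'm) hilbert_mod_scheme \<Rightarrow> 'x \<Rightarrow> 'a \<times> 'x \<Rightarrow> 'a \<times> 'x" where
  "corner E x = linking_op E 0 (\<lambda>_. 0) x (\<lambda>_. 0)"

context hilbert_module
begin

lemma ract_zero [simp]: "ract E x 0 = 0" "ract E 0 a = 0"
  using ract_add_right[of x 0 0] ract_add_left[of 0 0 a] by simp_all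

lemma ip_zero_right [simp]: "ip E x 0 = 0"
  using ip_add_right[of x 0 0] by simp

lemma star_0 [simp]: "star (0::'a) = 0"
  using star_add[of "0::'a" 0] by simp

lemma ip_zero_left [simp]: "ip E 0 x = 0"
  by (metis ip_zero_right star_0 star_ip)

lemma ip_add_left: "ip E (x + y) z = ip E x z + ip E y z"
  by (metis ip_add_right star_add star_ip)

lemma ip_ract_left: "ip E (ract E x a) y = star a * ip E x y"
  by (metis ip_ract_right star_ip star_mult)

lemma corner_in_linking_algebra: "corner E x \<in> linking_algebra E"
proof -
  have "compact_functional E (\<lambda>_. 0)"
    unfolding compact_functional_def
    by (intro allI impI exI[of _ 0]) (simp add: hnorm_def)
  moreover have "adjointable E (\<lambda>_. 0)"
    unfolding adjointable_def adjoint_pair_def by (intro exI[of _ "\<lambda>_. 0"]) simp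
  ultimately show ?thesis
    unfolding linking_algebra_def corner_def by blast
qed

lemma adjointable_corner: "adjointable (sum_module E) (corner E x)"
  unfolding adjointable_def adjoint_pair_def
  by (intro exI[of _ "\<lambda>(b, y). (ip E x y, 0)"])
    (auto simp: sum_module_def corner_def linking_op_def ip_ract_left)

lemma corner_right_action:
  "corner E x \<circ> linking_op E a (\<lambda>_. 0) 0 (\<lambda>_. 0) = corner E (ract E x a)"
  by (auto simp: corner_def linking_op_def ract_mult fun_eq_iff)

end

lemma (in cstar_correspondence) corner_left_action:
  "linking_op X 0 (\<lambda>_. 0) 0 (lact X a) \<circ> corner X x = corner X (lact X a x)"
proof -
  have lact_ract: "lact X a (ract X x b) = ract X (lact X a x) b" for b
  proof -
    let ?d = "lact X a (ract X x b) - ract X (lact X a x) b"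
    have "ip X (lact X a (ract X x b)) y = ip X (ract X (lact X a x) b) y" for y
      using lact_star[of a] by (simp add: adjoint_pair_def ip_ract_left)
    then have "ip X ?d y = 0" for y
      using ip_add_left[of ?d "ract X (lact X a x) b" y] by simp
    then show ?thesis
      using ip_definite[of ?d] by simp
  qed
  show ?thesis
    by (auto simp: corner_def linking_op_def lact_ract fun_eq_iff)
qed


section \<open>Operator space structure\<close>

text \<open>
  The \<open>n \<times> n\<close> matrices over the adjointable operators on \<open>E\<close> are the adjointable operators
  on the Hilbert module \<open>E\<^sup>n\<close> and carry the operator norm of the latter. Elements of \<open>E\<^sup>n\<close> and
  matrices are functions of indices \<open>< n\<close>; values at other indices are irrelevant.
\<close>

definition tuple_norm ::
    "('a::cstar_algebra, 'x, 'm) hilbert_mod_scheme \<Rightarrow> nat \<Rightarrow> (nat \<Rightarrow> 'x) \<Rightarrow> real" where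
  "tuple_norm E n \<xi> = sqrt (norm (\<Sum>i<n. ip E (\<xi> i) (\<xi> i)))"

definition op_matrix_norm ::
    "('a::cstar_algebra, 'x::ab_group_add, 'm) hilbert_mod_scheme \<Rightarrow> nat \<Rightarrow>
     (nat \<Rightarrow> nat \<Rightarrow> 'x \<Rightarrow> 'x) \<Rightarrow> real" where
  "op_matrix_norm E n T =
     (SUP \<xi>\<in>{\<xi>. tuple_norm E n \<xi> \<le> 1}. tuple_norm E n (\<lambda>i. \<Sum>j<n. T i j (\<xi> j)))"

definition module_matrix_norm ::
    "('a::cstar_algebra, 'x::ab_group_add, 'm) hilbert_mod_scheme \<Rightarrow> nat \<Rightarrow>
     (nat \<Rightarrow> nat \<Rightarrow> 'x) \<Rightarrow> real" where
  "module_matrix_norm E n x = op_matrix_norm (sum_module E) n (\<lambda>i j. corner E (x i j))"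

definition complete_isometry ::
    "('a::cstar_algebra, 'x::ab_group_add, 'm) hilbert_mod_scheme \<Rightarrow>
     ('b::cstar_algebra, 'y::ab_group_add, 'k) hilbert_mod_scheme \<Rightarrow> ('x \<Rightarrow> 'y) \<Rightarrow> bool" where
  "complete_isometry E F u \<longleftrightarrow>
     (\<forall>n x. module_matrix_norm F n (\<lambda>i j. u (x i j)) = module_matrix_norm E n x)"


section \<open>Isomorphisms\<close>

text \<open>
  Compatibility with the left and with the right action, that is, the identity
  \<open>u (\<phi>\<^sub>X(a) x a') = \<phi>\<^sub>Y(\<gamma> a) (u x) (\<gamma> a')\<close> where \<open>a\<close> and \<open>a'\<close> may also be an
  adjoined unit. Only asking for it with both \<open>a\<close> and \<open>a'\<close> in the algebra would say
  nothing about the right action when \<open>\<phi>\<^sub>X\<close> and \<open>\<phi>\<^sub>Y\<close> are zero.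
\<close>

definition bimodule_map ::
    "('a::cstar_algebra, 'x::ab_group_add) corr \<Rightarrow> ('b::cstar_algebra, 'y::ab_group_add) corr \<Rightarrow>
     ('a \<Rightarrow> 'b) \<Rightarrow> ('x \<Rightarrow> 'y) \<Rightarrow> bool" where
  "bimodule_map X Y \<gamma> u \<longleftrightarrow>
     (\<forall>a x. u (lact X a x) = lact Y (\<gamma> a) (u x)) \<and>
     (\<forall>x a. u (ract X x a) = ract Y (u x) (\<gamma> a))"

lemma bimodule_map_both:
  assumes "bimodule_map X Y \<gamma> u"
  shows "u (ract X (lact X a x) a') = ract Y (lact Y (\<gamma> a) (u x)) (\<gamma> a')"
  using assms by (simp add: bimodule_map_def)

text \<open>
  For unitary equivalences the identity with \<open>a\<close> and \<open>a'\<close> in the algebra suffices.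
\<close>

lemma bimodule_map_if_ip_preserving:
  assumes X: "cstar_correspondence X" and Y: "cstar_correspondence Y"
    and \<gamma>: "star_isomorphism \<gamma>" and "surj u"
    and ip: "\<And>x x'. ip Y (u x) (u x') = \<gamma> (ip X x x')"
    and both: "\<And>a x a'. u (ract X (lact X a x) a') = ract Y (lact Y (\<gamma> a) (u x)) (\<gamma> a')"
  shows "bimodule_map X Y \<gamma> u"
proof -
  interpret X: cstar_correspondence X by fact
  interpret Y: cstar_correspondence Y by fact
  have eqI: "y = y'" if "\<And>z. ip Y y z = ip Y y' z" for y y'
    using that Y.ip_add_left[of "y - y'" y' "y - y'"] Y.ip_definite[of "y - y'"] by simp
  have right: "u (ract X x a) = ract Y (u x) (\<gamma> a)" for x a
  proof (rule eqI)
    fix z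
    obtain w where "z = u w" using \<open>surj u\<close> by blast
    then show "ip Y (u (ract X x a)) z = ip Y (ract Y (u x) (\<gamma> a)) z"
      using \<gamma> by (simp add: ip X.ip_ract_left Y.ip_ract_left star_isomorphism_def)
  qed
  have "u (lact X a x) = lact Y (\<gamma> a) (u x)" for a x
  proof -
    let ?d = "u (lact X a x) - lact Y (\<gamma> a) (u x)"
    let ?h = "ip Y ?d ?d"
    obtain c where "\<gamma> c = ?h" using \<gamma> by (metis bij_pointE star_isomorphism_def)
    then have "ract Y ?d ?h = 0"
      using both[of a x c] right[of "lact X a x" c]
        Y.ract_add_left[of ?d "lact Y (\<gamma> a) (u x)" ?h] by simp
    then have "star ?h * ?h = 0"
      using Y.ip_ract_right[of ?d ?d ?h] by (simp add: Y.star_ip)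
    then have "?h = 0" using cstar_identity[of ?h] by simp
    then show ?thesis using Y.ip_definite[of ?d] by simp
  qed
  with right show ?thesis by (simp add: bimodule_map_def)
qed

definition completely_isometrically_isomorphic ::
    "('a::cstar_algebra, 'x::ab_group_add) corr \<Rightarrow> ('b::cstar_algebra, 'y::ab_group_add) corr \<Rightarrow>
     bool" where
  "completely_isometrically_isomorphic X Y \<longleftrightarrow>
     (\<exists>\<gamma> u. star_isomorphism \<gamma> \<and> Vector_Spaces.linear (hscale X) (hscale Y) u \<and> surj u \<and>
        complete_isometry X Y u \<and> bimodule_map X Y \<gamma> u)"

definition unitarily_equivalent ::
    "('a::cstar_algebra, 'x::ab_group_add) corr \<Rightarrow> ('b::cstar_algebra, 'y::ab_group_add) corr \<Rightarrow>
     bool" where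
  "unitarily_equivalent X Y \<longleftrightarrow>
     (\<exists>\<gamma> u. star_isomorphism \<gamma> \<and> Vector_Spaces.linear (hscale X) (hscale Y) u \<and> surj u \<and>
        bimodule_map X Y \<gamma> u \<and> (\<forall>x x'. ip Y (u x) (u x') = \<gamma> (ip X x x')))"

end

theory Submission
  imports Defs
begin

text \<open>
  A unitary equivalence \<open>(\<gamma>, u)\<close> induces the bijection \<open>(a, x) \<mapsto> (\<gamma> a, u x)\<close> between the modules on
  which the two linking algebras act. It carries inner products to inner products by \<open>\<gamma>\<close> and corners
  to corners, so \<open>u\<close> is a complete isometry as soon as \<open>\<gamma>\<close> is isometric.

  Conversely, let \<open>u\<close> be a complete isometry. The norm of the corner of \<open>x\<close>, a \<open>1 \<times> 1\<close> matrix, is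
  the Hilbert module norm of \<open>x\<close>, so \<open>u\<close> preserves the norm of \<open>x a\<close> for every \<open>a\<close>. Writing
  \<open>ip x x = b\<^sup>* b\<close> and \<open>ip (u x) (u x) = c\<^sup>* c\<close>, this says \<open>\<parallel>c d\<parallel> = \<parallel>\<gamma>(b) d\<parallel>\<close> for all \<open>d\<close>. Such an equality
  forces \<open>c\<^sup>* c = \<gamma>(b)\<^sup>* \<gamma>(b)\<close> (\<open>star_mult_self_eq_if_norm_mult_eq\<close>), and polarization passes from the
  diagonal to all inner products.

  The analytic content is thus: *-isomorphisms are isometric, and the functions \<open>d \<mapsto> \<parallel>b d\<parallel>\<close> determine
  \<open>b\<^sup>* b\<close>. Both are derived without spectral theory from two facts. An element \<open>1 - m\<close> with \<open>\<parallel>m\<parallel> \<le> 1\<close> has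
  a square root, the limit of an explicit iteration; and if \<open>s\<close>, \<open>r\<close> are commuting and selfadjoint, then
  \<open>\<parallel>s\<parallel>\<^sup>2 \<le> \<parallel>s\<^sup>2 + r\<^sup>2\<parallel>\<close>, because \<open>w = s + i r\<close> satisfies \<open>w\<^sup>* w = s\<^sup>2 + r\<^sup>2\<close>. In a unital C*-algebra
  these give the order: squares of selfadjoint elements are exactly the selfadjoint elements \<open>a\<close> with
  \<open>\<parallel>t - a\<parallel> \<le> t\<close> for some \<open>t\<close>, they form a proper convex cone, and the cone contains every \<open>c\<^sup>* c\<close>
  (\<open>nonneg_star_mult_self\<close>). Multiplying by \<open>(c\<^sup>* c + t)\<close> to the power \<open>-1/2\<close> then shows that
  \<open>\<parallel>b m\<parallel> \<le> \<parallel>c m\<parallel>\<close> for all \<open>m\<close> implies \<open>b\<^sup>* b \<le> c\<^sup>* c + t\<close> for all \<open>t > 0\<close>. A general C*-algebra is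
  reduced to the unital case by embedding it isometrically in its multiplier algebra.
\<close>

section \<open>Elementary identities in C*-algebras\<close>

lemma scaleC_one [simp]: "1 *\<^sub>C (x::'a::cstar_algebra) = x"
  using scaleC_of_real[of 1 x] by simp

lemma scaleC_zero_right [simp]: "c *\<^sub>C (0::'a::cstar_algebra) = 0"
  using scaleC_add_right[of c "0::'a" 0] by simp

lemma scaleC_minus_one: "(-1) *\<^sub>C (x::'a::cstar_algebra) = - x"
  using scaleC_of_real[of "-1" x] by simp

lemma star_zero [simp]: "star (0::'a::cstar_algebra) = 0"
  using star_add[of "0::'a" 0] by simp

lemma star_minus: "star (- x) = - star (x::'a::cstar_algebra)"
  using star_add[of x "- x"] by (simp add: eq_neg_iff_add_eq_0 add.commute)

lemma star_diff: "star (x - y) = star x - star (y::'a::cstar_algebra)"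
  using star_add[of x "- y"] by (simp add: star_minus)

lemma star_scaleR: "star (r *\<^sub>R x) = r *\<^sub>R star (x::'a::cstar_algebra)"
  by (metis complex_cnj_complex_of_real scaleC_of_real star_scaleC)

lemmas star_simps = star_minus star_add star_diff star_scaleR star_mult star_star

lemma norm_star [simp]: "norm (star x) = norm (x::'a::cstar_algebra)"
proof -
  have le: "norm y \<le> norm (star y)" for y :: 'a
  proof (cases "y = 0")
    case False
    have "norm y * norm y \<le> norm (star y) * norm y"
      using cstar_identity[of y] norm_mult_ineq[of "star y" y] by (simp add: power2_eq_square)
    then show ?thesis using False by simp
  qed simp
  show ?thesis using le[of x] le[of "star x"] by (simp add: star_star)
qed

lemma bounded_linear_star: "bounded_linear (star :: 'a::cstar_algebra \<Rightarrow> 'a)"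
  by (rule bounded_linear_intro[where K = 1]) (simp_all add: star_simps)

lemma eqI_star_mult:
  fixes x y :: "'a::cstar_algebra"
  assumes "\<And>z. star z * x = star z * y"
  shows "x = y"
proof -
  have "star (x - y) * (x - y) = 0"
    using assms[of "x - y"] by (simp add: right_diff_distrib)
  then show ?thesis using cstar_identity[of "x - y"] by simp
qed

section \<open>Square roots by iteration\<close>

text \<open>
  The solution \<open>k = 1 - sqrt (1 - m)\<close> of \<open>(1 - k)\<^sup>2 = 1 - m\<close>, phrased without a unit. The iteration
  \<open>k \<mapsto> (m + k\<^sup>2) / 2\<close> from \<open>0\<close> is dominated by the same iteration with \<open>m = 1\<close> on the reals, which
  increases and is bounded by \<open>1\<close>. Hence it converges also in the boundary case \<open>norm m = 1\<close>, where the map is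
  no strict contraction. The last clause transfers closed properties, such as being selfadjoint, from
  the iterates to \<open>k\<close>.
\<close>

lemma banach_sqrt:
  fixes m :: "'a::{real_normed_algebra, banach}"
  assumes m: "norm m \<le> 1"
  shows "\<exists>k. k + k = m + k * k \<and> norm k \<le> 1 \<and>
    (\<forall>S. closed S \<longrightarrow> 0 \<in> S \<longrightarrow> (\<forall>x\<in>S. (1/2) *\<^sub>R (m + x * x) \<in> S) \<longrightarrow> k \<in> S)"
proof -
  define F where "F x = (1/2) *\<^sub>R (m + x * x)" for x :: 'a
  define \<kappa> where "\<kappa> n = ((\<lambda>r. (1 + r * r) / 2) ^^ n) (0::real)" for n
  define K where "K n = (F ^^ n) 0" for n
  have \<kappa>0: "\<kappa> 0 = 0" and \<kappa>S: "\<kappa> (Suc n) = (1 + \<kappa> n * \<kappa> n) / 2" for n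
    by (simp_all add: \<kappa>_def)
  have K0: "K 0 = 0" and KS: "K (Suc n) = F (K n)" for n
    by (simp_all add: K_def)
  have \<kappa>: "0 \<le> \<kappa> n \<and> \<kappa> n \<le> 1" for n
  proof (induction n)
    case (Suc n)
    then have "\<kappa> n * \<kappa> n \<le> 1 * 1" by (intro mult_mono) auto
    with Suc show ?case by (simp add: \<kappa>S)
  qed (simp add: \<kappa>0)
  have \<kappa>_mono: "\<kappa> n \<le> \<kappa> (Suc n)" for n
    using sum_squares_ge_zero[of "\<kappa> n - 1" 0] by (simp add: \<kappa>S algebra_simps)
  have K_le: "norm (K n) \<le> \<kappa> n" for n
  proof (induction n)
    case (Suc n)
    have "norm (m + K n * K n) \<le> norm m + norm (K n) * norm (K n)"
      by (meson add_left_mono norm_mult_ineq norm_triangle_le)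
    also have "\<dots> \<le> 1 + \<kappa> n * \<kappa> n"
      using Suc m by (intro add_mono mult_mono) (auto intro: order_trans[OF norm_ge_zero])
    finally show ?case by (simp add: KS \<kappa>S F_def)
  qed (simp add: K0 \<kappa>0)
  \<comment> \<open>The increments of \<open>\<kappa>\<close> majorize those of \<open>K\<close>, and they telescope.\<close>
  have step: "norm (K (Suc n) - K n) \<le> \<kappa> (Suc n) - \<kappa> n" for n
  proof (induction n)
    case 0
    then show ?case using m by (simp add: KS K0 \<kappa>S \<kappa>0 F_def)
  next
    case (Suc n)
    let ?x = "K (Suc n)" and ?y = "K n"
    have "?x * ?x - ?y * ?y = ?x * (?x - ?y) + (?x - ?y) * ?y"
      by (simp add: algebra_simps)
    then have "norm (?x * ?x - ?y * ?y) \<le> norm ?x * norm (?x - ?y) + norm (?x - ?y) * norm ?y"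
      by (metis add_mono norm_mult_ineq norm_triangle_le)
    also have "\<dots> \<le> \<kappa> (Suc n) * (\<kappa> (Suc n) - \<kappa> n) + (\<kappa> (Suc n) - \<kappa> n) * \<kappa> n"
      using Suc K_le[of n] K_le[of "Suc n"] \<kappa>[of n] \<kappa>[of "Suc n"] \<kappa>_mono[of n]
      by (intro add_mono mult_mono) auto
    also have "\<dots> = 2 * (\<kappa> (Suc (Suc n)) - \<kappa> (Suc n))"
      using \<kappa>S[of n] \<kappa>S[of "Suc n"] by (simp add: algebra_simps)
    finally have "norm ((1/2) *\<^sub>R (?x * ?x - ?y * ?y)) \<le> \<kappa> (Suc (Suc n)) - \<kappa> (Suc n)"
      by simp
    moreover have "K (Suc (Suc n)) - K (Suc n) = (1/2) *\<^sub>R (?x * ?x - ?y * ?y)"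
      by (subst (1 2) KS) (simp add: F_def scaleR_diff_right[symmetric] del: scaleR_half_double)
    ultimately show ?case by simp
  qed
  have "incseq \<kappa>" using \<kappa>_mono by (rule incseq_SucI)
  then have "convergent \<kappa>"
    using \<kappa> by (metis incseq_convergent convergentI)
  then have "summable (\<lambda>n. \<kappa> (Suc n) - \<kappa> n)"
    by (metis convergent_LIMSEQ_iff telescope_summable)
  then have "summable (\<lambda>n. K (Suc n) - K n)"
    by (rule summable_comparison_test') (rule step)
  then have "convergent K"
    by (simp add: summable_iff_convergent sum_lessThan_telescope K0)
  then obtain k where k: "K \<longlonglongrightarrow> k" by (auto simp: convergent_def)
  have "(\<lambda>n. K (Suc n)) \<longlonglongrightarrow> F k"
    unfolding KS F_def by (intro tendsto_intros k)
  then have "k = F k" using k LIMSEQ_Suc LIMSEQ_unique by blast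
  then have "k + k = F k + F k" by simp
  then have 1: "k + k = m + k * k"
    by (simp add: F_def flip: scaleR_2)
  have 2: "norm k \<le> 1"
    by (rule Lim_norm_ubound[OF _ k]) (use K_le \<kappa> in \<open>auto intro!: always_eventually intro: order_trans\<close>)
  have 3: "k \<in> S" if "closed S" "0 \<in> S" "\<forall>x\<in>S. (1/2) *\<^sub>R (m + x * x) \<in> S" for S
  proof -
    have "K n \<in> S" for n by (induction n) (use that in \<open>auto simp: K0 KS F_def\<close>)
    then show ?thesis using closed_sequentially[OF that(1)] k by blast
  qed
  show ?thesis using 1 2 3 by blast
qed

lemma closed_fixed_star: "closed {x::'a::cstar_algebra. star x = x}"
  by (intro closed_Collect_eq continuous_intros
      linear_continuous_on[OF bounded_linear_star])

lemma closed_commutant: "closed {x::'a::real_normed_algebra. x * b = b * x}"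
  by (intro closed_Collect_eq continuous_intros)

lemma cstar_sqrt:
  fixes m :: "'a::cstar_algebra"
  assumes "norm m \<le> 1" and m: "star m = m"
  obtains k where "k + k = m + k * k" "norm k \<le> 1" "star k = k"
    "\<And>b. m * b = b * m \<Longrightarrow> k * b = b * k"
proof -
  obtain k where k: "k + k = m + k * k" "norm k \<le> 1" and
    in_S: "\<And>S. closed S \<Longrightarrow> 0 \<in> S \<Longrightarrow> (\<forall>x\<in>S. (1/2) *\<^sub>R (m + x * x) \<in> S) \<Longrightarrow> k \<in> S"
    using banach_sqrt[OF assms(1)] by blast
  have "k \<in> {x. star x = x}"
    by (rule in_S) (auto simp: closed_fixed_star star_simps m)
  moreover have "k \<in> {x. x * b = b * x}" if "m * b = b * m" for b
  proof (rule in_S; (rule ballI)?)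
    fix x assume "x \<in> {x. x * b = b * x}"
    then have "x * b = b * x" by simp
    then have "x * x * b = b * (x * x)" by (metis mult.assoc)
    then show "(1/2) *\<^sub>R (m + x * x) \<in> {x. x * b = b * x}"
      using that by (simp add: distrib_left distrib_right)
  qed (auto simp: closed_commutant)
  ultimately show ?thesis by (intro that[OF k]) simp_all
qed

section \<open>The positive cone of a unital C*-algebra\<close>

text \<open>
  The unital C*-algebras are those of sort \<open>{cstar_algebra, monoid_mult}\<close>. The class \<open>ring_1\<close> would
  exclude the zero algebra, whose multiplier algebra is zero too; hence only \<open>norm 1 \<le> 1\<close> holds in
  general.

  Positivity is first taken to mean having a selfadjoint square root. That this agrees with
  the form \<open>star c * c\<close> is the hardest property of the cone.
\<close>

definition nonneg :: "'a::cstar_algebra \<Rightarrow> bool" where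
  "nonneg a \<longleftrightarrow> (\<exists>s. star s = s \<and> a = s * s)"

lemma star_nonneg: "nonneg a \<Longrightarrow> star a = a"
  by (auto simp: nonneg_def star_mult)

lemma norm_square_selfadjoint:
  fixes s :: "'a::cstar_algebra"
  assumes "star s = s"
  shows "norm (s * s) = (norm s)\<^sup>2"
  using cstar_identity[of s] assms by simp

lemma scaleC_diff_right: "c *\<^sub>C (x - y) = c *\<^sub>C x - c *\<^sub>C (y::'a::cstar_algebra)"
  by (metis add_diff_cancel_right' diff_add_cancel scaleC_add_right)

lemma cartesian_square:
  fixes s r :: "'a::cstar_algebra"
  assumes "star s = s" "star r = r"
  shows "star (s + \<i> *\<^sub>C r) * (s + \<i> *\<^sub>C r) = s * s + r * r + \<i> *\<^sub>C (s * r - r * s)"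
proof -
  have "\<i> *\<^sub>C \<i> *\<^sub>C x = - x" for x :: 'a
    by (simp add: scaleC_scaleC scaleC_minus_one)
  moreover have "(- \<i>) *\<^sub>C x = - (\<i> *\<^sub>C x)" for x :: 'a
    using scaleC_scaleC[of "-1" \<i> x] by (simp add: scaleC_minus_one)
  ultimately show ?thesis
    by (simp add: star_add star_scaleC assms mult_scaleC_left mult_scaleC_right distrib_left distrib_right
        scaleC_add_right scaleC_diff_right algebra_simps)
qed

text \<open>
  The substitute for functional calculus of two commuting elements: \<open>s\<close> is the real part of
  \<open>s + \<i> r\<close>, whose norm the C*-identity computes.
\<close>

lemma norm_commuting_le:
  fixes s r :: "'a::cstar_algebra"
  assumes s: "star s = s" and r: "star r = r" and "s * r = r * s"
  shows "(norm s)\<^sup>2 \<le> norm (s * s + r * r)"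
proof -
  define w where "w = s + \<i> *\<^sub>C r"
  have "star w * w = s * s + r * r"
    using cartesian_square[OF s r] assms(3) by (simp add: w_def)
  then have w: "(norm w)\<^sup>2 = norm (s * s + r * r)"
    by (metis cstar_identity)
  have "star w = s - \<i> *\<^sub>C r"
    using scaleC_scaleC[of "-1" \<i> r] by (simp add: w_def star_add star_scaleC s r scaleC_minus_one)
  then have "2 *\<^sub>R s = w + star w" by (simp add: w_def scaleR_2)
  then have "2 * norm s = norm (w + star w)" by (metis norm_scaleR abs_numeral)
  then have "norm s \<le> norm w"
    using norm_triangle_ineq[of w "star w"] by simp
  then show ?thesis using w by (metis norm_ge_zero power_mono)
qed

lemma star_one [simp]: "star (1::'a::{cstar_algebra,monoid_mult}) = 1"
  by (metis mult_1_left star_mult star_star)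

lemma norm_one_le: "norm (1::'a::{cstar_algebra,monoid_mult}) \<le> 1"
proof -
  have "norm (1::'a) * norm (1::'a) = norm (1::'a)"
    using norm_square_selfadjoint[of "1::'a"] by (simp add: power2_eq_square)
  then show ?thesis by (metis mult_cancel_right1 order_refl zero_le_one)
qed

lemma norm_scaleR_one_le: "0 \<le> t \<Longrightarrow> norm (t *\<^sub>R (1::'a::{cstar_algebra,monoid_mult})) \<le> t"
  using mult_left_mono[OF norm_one_le, of t] by simp

text \<open>
  Functions of \<open>a\<close> commute with everything that commutes with \<open>a\<close>; recording this for the root allows
  roots of commuting elements to be multiplied. The norm estimate makes the root itself nonnegative.
\<close>

lemma sqrt_exists:
  fixes a :: "'a::{cstar_algebra,monoid_mult}"
  assumes a: "star a = a" and le: "norm (t *\<^sub>R 1 - a) \<le> t"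
  obtains s where "star s = s" "a = s * s" "norm (sqrt t *\<^sub>R 1 - s) \<le> sqrt t"
    "\<forall>b. a * b = b * a \<longrightarrow> s * b = b * s"
proof (cases "t = 0")
  case True
  then have "a = 0" using le by simp
  then show ?thesis using that[of 0] True by simp
next
  case False
  then have t: "t > 0" using le norm_ge_zero[of "t *\<^sub>R 1 - a"] by linarith
  define m where "m = 1 - (1/t) *\<^sub>R a"
  have a_eq: "a = t *\<^sub>R (1 - m)" using t by (simp add: m_def)
  have "t * norm m = norm (t *\<^sub>R 1 - a)"
    using t by (simp add: a_eq scaleR_diff_right)
  then have "norm m \<le> 1"
    using le t by (metis mult_le_cancel_left_pos mult.right_neutral)
  moreover have "star m = m" by (simp add: m_def star_simps a)
  ultimately obtain k where k: "k + k = m + k * k" "norm k \<le> 1" "star k = k"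
    and comm: "\<And>b. m * b = b * m \<Longrightarrow> k * b = b * k"
    using cstar_sqrt by blast
  define s where "s = sqrt t *\<^sub>R (1 - k)"
  have "(1 - k) * (1 - k) = 1 - (k + k) + k * k"
    by (simp add: algebra_simps)
  then have sq: "a = s * s" using t by (simp add: s_def a_eq k(1))
  have sa: "star s = s" by (simp add: s_def star_simps k)
  have nm: "norm (sqrt t *\<^sub>R 1 - s) \<le> sqrt t"
    using k(2) t mult_left_mono[OF k(2), of "sqrt t"] by (simp add: s_def flip: scaleR_diff_right)
  have cm: "\<forall>b. a * b = b * a \<longrightarrow> s * b = b * s"
    using comm by (simp add: s_def m_def left_diff_distrib right_diff_distrib)
  show ?thesis by (rule that[OF sa sq nm cm])
qed

text \<open>
  With \<open>e\<close> the root of \<open>t - s\<^sup>2\<close>, the two squares add up to \<open>t\<close>, so neither of them can exceed \<open>t\<close> in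
  norm. Together with \<open>sqrt_exists\<close> this characterizes squares by a norm inequality that is
  visibly stable under sums.
\<close>

lemma norm_diff_square_le:
  fixes s :: "'a::{cstar_algebra,monoid_mult}"
  assumes s: "star s = s" and le: "(norm s)\<^sup>2 \<le> t"
  shows "norm (t *\<^sub>R 1 - s * s) \<le> t"
proof -
  have sa: "star (t *\<^sub>R 1 - s * s) = t *\<^sub>R 1 - s * s"
    by (simp add: star_simps s)
  have "norm (t *\<^sub>R 1 - (t *\<^sub>R 1 - s * s)) \<le> t"
    using le by (simp add: norm_square_selfadjoint s)
  then obtain e where e: "star e = e" "t *\<^sub>R 1 - s * s = e * e"
    and comm: "\<forall>b. (t *\<^sub>R 1 - s * s) * b = b * (t *\<^sub>R 1 - s * s) \<longrightarrow> e * b = b * e"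
    by (rule sqrt_exists[OF sa])
  have "e * s = s * e"
    by (rule comm[rule_format]) (simp add: algebra_simps)
  then have "(norm e)\<^sup>2 \<le> norm (e * e + s * s)"
    using norm_commuting_le e(1) s by blast
  also have "e * e + s * s = t *\<^sub>R 1" by (simp flip: e(2))
  also have "norm (t *\<^sub>R (1::'a)) \<le> t"
    by (rule norm_scaleR_one_le) (use le zero_le_power2 order_trans in blast)
  finally show ?thesis by (simp add: e norm_square_selfadjoint)
qed

lemma nonneg_norm:
  fixes a :: "'a::{cstar_algebra,monoid_mult}"
  assumes "nonneg a" "norm a \<le> t"
  shows "norm (t *\<^sub>R 1 - a) \<le> t"
proof -
  obtain s where "star s = s" "a = s * s" using assms(1) by (auto simp: nonneg_def)
  with assms(2) show ?thesis
    by (simp add: norm_diff_square_le norm_square_selfadjoint)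
qed

lemma nonnegI:
  fixes a :: "'a::{cstar_algebra,monoid_mult}"
  assumes "star a = a" "norm (t *\<^sub>R 1 - a) \<le> t"
  shows "nonneg a"
  using sqrt_exists[OF assms] unfolding nonneg_def by blast

lemma nonneg_sqrt:
  fixes a :: "'a::{cstar_algebra,monoid_mult}"
  assumes "nonneg a"
  obtains s where "nonneg s" "a = s * s" "\<forall>b. a * b = b * a \<longrightarrow> s * b = b * s"
proof (rule sqrt_exists[OF star_nonneg[OF assms] nonneg_norm[OF assms order_refl]])
  fix s
  assume "star s = s" "a = s * s" "norm (sqrt (norm a) *\<^sub>R 1 - s) \<le> sqrt (norm a)"
    and "\<forall>b. a * b = b * a \<longrightarrow> s * b = b * s"
  then show thesis by (intro that[of s] nonnegI[of s "sqrt (norm a)"])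
qed

lemma nonneg_square: "star s = s \<Longrightarrow> nonneg (s * s)"
  unfolding nonneg_def by blast

lemma nonneg_one: "nonneg (1::'a::{cstar_algebra,monoid_mult})"
  using nonneg_square[of "1::'a"] by simp

lemma nonneg_scaleR:
  assumes "nonneg a" "0 \<le> t"
  shows "nonneg (t *\<^sub>R a)"
proof -
  obtain s where "star s = s" "a = s * s" using assms(1) by (auto simp: nonneg_def)
  then have "star (sqrt t *\<^sub>R s) = sqrt t *\<^sub>R s" "t *\<^sub>R a = (sqrt t *\<^sub>R s) * (sqrt t *\<^sub>R s)"
    using assms(2) by (simp_all add: star_simps)
  then show ?thesis unfolding nonneg_def by blast
qed

lemma nonneg_add:
  fixes a b :: "'a::{cstar_algebra,monoid_mult}"
  assumes "nonneg a" "nonneg b"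
  shows "nonneg (a + b)"
proof (rule nonnegI)
  have "(norm a + norm b) *\<^sub>R 1 - (a + b) = (norm a *\<^sub>R 1 - a) + (norm b *\<^sub>R 1 - b)"
    by (simp add: algebra_simps)
  then show "norm ((norm a + norm b) *\<^sub>R 1 - (a + b)) \<le> norm a + norm b"
    using nonneg_norm[OF assms(1) order_refl] nonneg_norm[OF assms(2) order_refl]
    by (metis add_mono norm_triangle_le)
qed (simp add: star_add star_nonneg assms)

lemma nonneg_mult_commuting:
  fixes a b :: "'a::{cstar_algebra,monoid_mult}"
  assumes "nonneg a" "nonneg b" "a * b = b * a"
  shows "nonneg (a * b)"
proof -
  obtain s where s: "nonneg s" "a = s * s" "\<forall>c. a * c = c * a \<longrightarrow> s * c = c * s"
    by (rule nonneg_sqrt[OF assms(1)])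
  obtain r where r: "nonneg r" "b = r * r" "\<forall>c. b * c = c * b \<longrightarrow> r * c = c * r"
    by (rule nonneg_sqrt[OF assms(2)])
  have "b * s = s * b" using s(3)[rule_format, OF assms(3)] by (rule sym)
  then have rs: "r * s = s * r" by (rule r(3)[rule_format])
  have "a * b = (s * r) * (s * r)"
  proof -
    have "s * r * (s * r) = s * (r * s) * r" by (simp only: mult.assoc)
    also have "\<dots> = a * b" by (simp only: rs mult.assoc s(2) r(2))
    finally show ?thesis by simp
  qed
  moreover have "star (s * r) = s * r"
    by (simp only: star_mult star_nonneg[OF s(1)] star_nonneg[OF r(1)] rs)
  ultimately show ?thesis using nonneg_square[of "s * r"] by simp
qed

lemma norm_le_add_commuting:
  fixes a b :: "'a::{cstar_algebra,monoid_mult}"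
  assumes "nonneg a" "nonneg b" "a * b = b * a"
  shows "norm a \<le> norm (a + b)"
proof -
  obtain s where s: "nonneg s" "a = s * s" "\<forall>c. a * c = c * a \<longrightarrow> s * c = c * s"
    by (rule nonneg_sqrt[OF assms(1)])
  obtain r where r: "nonneg r" "b = r * r" "\<forall>c. b * c = c * b \<longrightarrow> r * c = c * r"
    by (rule nonneg_sqrt[OF assms(2)])
  have "b * s = s * b" using s(3)[rule_format, OF assms(3)] by (rule sym)
  then have "r * s = s * r" by (rule r(3)[rule_format])
  then show ?thesis
    using norm_commuting_le[of s r] star_nonneg[OF s(1)] star_nonneg[OF r(1)]
    by (simp only: s(2) r(2) norm_square_selfadjoint)
qed

lemma nonneg_antisym:
  fixes a :: "'a::{cstar_algebra,monoid_mult}"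
  assumes "nonneg a" "nonneg (- a)"
  shows "a = 0"
  using norm_le_add_commuting[OF assms] by simp

text \<open>
  Comparing \<open>b\<close> with its norm reduces the claim to \<open>a \<le> norm b\<close>, where \<open>a\<close> and the scalar commute.
\<close>

lemma norm_mono:
  fixes a b :: "'a::{cstar_algebra,monoid_mult}"
  assumes a: "nonneg a" and ba: "nonneg (b - a)"
  shows "norm a \<le> norm b"
proof -
  have "nonneg (norm b *\<^sub>R 1 - b)"
    using nonnegI[of "norm b *\<^sub>R 1 - b" "norm b"] star_nonneg[OF nonneg_add[OF ba a]]
    by (simp add: star_diff star_scaleR)
  from nonneg_add[OF this ba] have "nonneg (norm b *\<^sub>R 1 - a)" by simp
  from norm_le_add_commuting[OF a this] have "norm a \<le> norm (norm b *\<^sub>R (1::'a))"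
    by (simp add: algebra_simps)
  also have "\<dots> \<le> norm b" by (rule norm_scaleR_one_le) simp
  finally show ?thesis .
qed

lemma nonneg_limit:
  fixes a :: "'a::{cstar_algebra,monoid_mult}"
  assumes a: "\<And>t. t > 0 \<Longrightarrow> nonneg (a + t *\<^sub>R 1)"
  shows "nonneg a"
proof (rule nonnegI)
  have "star (a + 1) = a + 1"
    using star_nonneg[OF a[of 1]] by simp
  then show "star a = a" by (simp add: star_add)
  show "norm (norm a *\<^sub>R 1 - a) \<le> norm a"
  proof (rule field_le_epsilon)
    fix t :: real assume t: "t > 0"
    have "norm (a + t *\<^sub>R 1) \<le> norm a + t"
      using norm_triangle_ineq[of a "t *\<^sub>R 1"] norm_scaleR_one_le[of t, where 'a = 'a] t by linarith
    from nonneg_norm[OF a[OF t] this] show "norm (norm a *\<^sub>R 1 - a) \<le> norm a + t"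
      by (simp add: scaleR_add_left)
  qed
qed

section \<open>Elements of the form \<open>star c * c\<close> are positive\<close>

text \<open>
  Suppose \<open>f = - w\<^sup>* w\<close> is nonnegative. Adding \<open>w w\<^sup>* + w\<^sup>* w\<close>, which is a sum of two squares, shows
  that \<open>z = w w\<^sup>*\<close> is nonnegative as well. From \<open>f w\<^sup>* = - w\<^sup>* z\<close> follows
  \<open>w\<^sup>* (t + z) = (t - f) w\<^sup>*\<close>. For \<open>t = norm f = norm z\<close> the right side has norm at most
  \<open>t * norm w\<close>, but the left side is larger unless \<open>t = 0\<close>. This replaces the comparison of the
  spectra of \<open>w\<^sup>* w\<close> and \<open>w w\<^sup>*\<close>.
\<close>

lemma eq_zero_if_minus_nonneg:
  fixes w :: "'a::{cstar_algebra,monoid_mult}"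
  assumes f: "nonneg (- (star w * w))"
  shows "w = 0"
proof -
  define f where "f = - (star w * w)"
  define z where "z = w * star w"
  define t where "t = (norm w)\<^sup>2"
  have "t \<ge> 0" by (simp add: t_def)
  have norm_f: "norm f = t" and norm_z: "norm z = t"
    using cstar_identity[of w] cstar_identity[of "star w"]
    by (simp_all add: f_def z_def t_def star_star)
  have "nonneg z"
  proof -
    \<comment> \<open>\<open>P / 2\<close> and \<open>Q / 2\<close> are, up to sign, the real and the imaginary part of \<open>w\<close>.\<close>
    define P where "P = w + star w"
    define Q where "Q = \<i> *\<^sub>C (w - star w)"
    have "star P = P" by (simp add: P_def star_simps add.commute)
    moreover have "star Q = Q"
    proof -
      have "star Q = (-1 * \<i>) *\<^sub>C (star w - w)"
        by (simp add: Q_def star_scaleC star_diff star_star)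
      also have "\<dots> = \<i> *\<^sub>C (w - star w)"
        unfolding scaleC_scaleC[symmetric] by (simp add: scaleC_minus_one scaleC_diff_right)
      finally show ?thesis by (simp add: Q_def)
    qed
    moreover have "Q * Q = - ((w - star w) * (w - star w))"
      by (simp add: Q_def mult_scaleC_left mult_scaleC_right scaleC_scaleC scaleC_minus_one)
    then have "P * P + Q * Q = 2 *\<^sub>R (w * star w + star w * w)"
      by (simp add: P_def algebra_simps scaleR_2)
    then have "z = (1/2) *\<^sub>R (P * P + Q * Q) + f"
      by (simp add: z_def f_def)
    moreover have "nonneg f" using f by (simp add: f_def)
    ultimately show ?thesis
      by (simp only:) (intro nonneg_add nonneg_scaleR nonneg_square; simp)
  qed
  define d where "d = star w * (t *\<^sub>R 1 + z)"
  have "d = (t *\<^sub>R 1 - f) * star w"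
    by (simp add: d_def f_def z_def algebra_simps)
  then have "norm d \<le> norm (t *\<^sub>R 1 - f) * norm w"
    by (metis norm_mult_ineq norm_star)
  also have "\<dots> \<le> t * norm w"
    using nonneg_norm[of f t] f norm_f by (intro mult_right_mono) (auto simp: f_def)
  finally have "(norm d)\<^sup>2 \<le> (t * norm w)\<^sup>2" by (intro power_mono) auto
  then have "norm (star d * d) \<le> t * t * t"
    by (simp add: cstar_identity power_mult_distrib t_def power2_eq_square)
  \<comment> \<open>The first summand alone has norm \<open>2 * t ^ 3\<close>, while \<open>norm (star d * d) \<le> t ^ 3\<close>.\<close>
  moreover have "star d * d = 2 *\<^sub>R t *\<^sub>R (z * z) + (t *\<^sub>R t *\<^sub>R z + z * (z * z))"
  proof -
    have "star d * d = (t *\<^sub>R 1 + z) * z * (t *\<^sub>R 1 + z)"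
      using star_nonneg[OF \<open>nonneg z\<close>]
      by (simp add: d_def star_simps z_def[symmetric] mult.assoc)
        (simp add: z_def mult.assoc)
    then show ?thesis unfolding scaleR_2 by (simp add: algebra_simps)
  qed
  moreover have "norm (2 *\<^sub>R t *\<^sub>R (z * z)) \<le> norm (2 *\<^sub>R t *\<^sub>R (z * z) + (t *\<^sub>R t *\<^sub>R z + z * (z * z)))"
  proof (rule norm_le_add_commuting)
    have zz: "nonneg (z * z)"
      using \<open>nonneg z\<close> by (simp add: nonneg_mult_commuting)
    then show "nonneg (2 *\<^sub>R t *\<^sub>R (z * z))"
      using \<open>t \<ge> 0\<close> by (intro nonneg_scaleR) auto
    show "nonneg (t *\<^sub>R t *\<^sub>R z + z * (z * z))"
      using \<open>t \<ge> 0\<close> \<open>nonneg z\<close> zz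
      by (intro nonneg_add nonneg_scaleR nonneg_mult_commuting) (auto simp: mult.assoc)
  qed (simp add: algebra_simps)
  moreover have "norm (z * z) = t * t"
    using norm_square_selfadjoint[OF star_nonneg[OF \<open>nonneg z\<close>]] by (simp add: norm_z power2_eq_square)
  ultimately have "2 * (t * t * t) \<le> t * t * t" using \<open>t \<ge> 0\<close> by (simp add: mult.assoc)
  then have "t * t * t \<le> 0" by simp
  then have "t = 0" using \<open>t \<ge> 0\<close> by (simp add: mult_le_0_iff)
  then show ?thesis by (simp add: t_def)
qed

text \<open>
  Let \<open>h = c\<^sup>* c\<close>, let \<open>m\<close> be its absolute value and \<open>g = m - h\<close>, twice the negative part of \<open>h\<close>. Then
  \<open>(c g)\<^sup>* (c g) = g h g = - g\<^sup>2 m\<close> is nonpositive, so \<open>c g = 0\<close> by the previous lemma.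
  That gives \<open>g\<^sup>2 = 0\<close>, hence \<open>h = m\<close>.
\<close>

lemma nonneg_star_mult_self:
  fixes c :: "'a::{cstar_algebra,monoid_mult}"
  shows "nonneg (star c * c)"
proof -
  define h where "h = star c * c"
  have h: "star h = h" by (simp add: h_def star_simps)
  obtain m where m: "nonneg m" "h * h = m * m"
    and comm: "\<forall>b. h * h * b = b * (h * h) \<longrightarrow> m * b = b * m"
    by (rule nonneg_sqrt[OF nonneg_square[OF h]])
  have mh: "m * h = h * m" by (rule comm[rule_format]) (simp add: mult.assoc)
  define g where "g = m - h"
  have g: "star g = g" by (simp add: g_def star_diff h star_nonneg[OF m(1)])
  have gg: "g * g = 2 *\<^sub>R (g * m)"
    using m(2) mh by (simp add: g_def algebra_simps scaleR_2)
  have gm: "g * m = m * g" using mh by (simp add: g_def algebra_simps)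
  have gh: "g * h = - (g * m)"
    using m(2) mh by (simp add: g_def algebra_simps)
  have "star (c * g) * (c * g) = g * h * g"
    by (simp add: star_mult g h_def mult.assoc)
  also have "\<dots> = - (g * g * m)"
    by (simp only: gh mult_minus_left mult.assoc gm[symmetric])
  finally have "- (star (c * g) * (c * g)) = g * g * m" by simp
  moreover have "nonneg (g * g * m)"
  proof (rule nonneg_mult_commuting[OF nonneg_square[OF g] m(1)])
    show "g * g * m = m * (g * g)" using gm by (metis mult.assoc)
  qed
  ultimately have "c * g = 0" using eq_zero_if_minus_nonneg by metis
  then have "h * g = 0" by (simp add: h_def mult.assoc)
  then have "g * m = 0"
    using gh mh by (metis g h minus_equation_iff minus_zero star_mult star_zero)
  then have "g * g = 0" using gg by simp
  then have "norm g = 0" using norm_square_selfadjoint[OF g] by simp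
  then have "h = m" by (simp add: g_def)
  then show ?thesis using m(1) by (simp add: h_def)
qed

lemma nonneg_conjugate:
  fixes a b :: "'a::{cstar_algebra,monoid_mult}"
  assumes "nonneg a"
  shows "nonneg (star b * a * b)"
proof -
  obtain s where "star s = s" "a = s * s" using assms by (auto simp: nonneg_def)
  then have "star b * a * b = star (s * b) * (s * b)" by (simp add: star_mult mult.assoc)
  then show ?thesis by (simp add: nonneg_star_mult_self)
qed

section \<open>The norms \<open>norm (b * m)\<close> determine \<open>star b * b\<close>\<close>

text \<open>
  The inverse of \<open>q + t\<close> solves \<open>x = 1 / N + (1 - (q + t) / N) x\<close>. For \<open>N = norm q + t\<close> the map on the right is a
  contraction, as \<open>norm (norm q - q) \<le> norm q < N\<close>.
\<close>

lemma nonneg_resolvent: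
  fixes q :: "'a::{cstar_algebra,monoid_mult}"
  assumes q: "nonneg q" and t: "t > 0"
  obtains x where "nonneg x" "x * (q + t *\<^sub>R 1) = 1" "(q + t *\<^sub>R 1) * x = 1"
proof -
  define N where "N = norm q + t"
  have N: "N > 0" using t by (simp add: N_def add_nonneg_pos)
  define m where "m = (1/N) *\<^sub>R (norm q *\<^sub>R 1 - q)"
  define y where "y = q + t *\<^sub>R 1"
  have "norm m \<le> norm q / N"
    using nonneg_norm[OF q order_refl] N by (simp add: m_def divide_right_mono)
  also have "norm q / N < 1" using N t by (simp add: N_def)
  finally have m: "norm m < 1" .
  have "\<forall>x x'. dist ((1/N) *\<^sub>R 1 + m * x) ((1/N) *\<^sub>R 1 + m * x') \<le> norm m * dist x x'"
    by (simp add: dist_norm flip: right_diff_distrib) (meson norm_mult_ineq)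
  from banach_fix_type[OF norm_ge_zero m this]
  obtain x where x: "(1/N) *\<^sub>R 1 + m * x = x" by blast
  have "N *\<^sub>R x = 1 + (N *\<^sub>R m) * x"
    using arg_cong[OF x, of "\<lambda>x. N *\<^sub>R x"] N by (simp add: scaleR_add_right)
  moreover have "N *\<^sub>R m = norm q *\<^sub>R 1 - q" using N by (simp add: m_def)
  then have "N *\<^sub>R m = N *\<^sub>R 1 - y" by (simp add: y_def N_def scaleR_add_left)
  ultimately have yx: "y * x = 1" by (simp add: left_diff_distrib)
  have y: "star y = y" by (simp add: y_def star_simps star_nonneg[OF q])
  have xy: "star x * y = 1" using arg_cong[OF yx, of star] by (simp add: star_mult y)
  have sx: "star x = x" using xy yx by (metis mult.assoc mult_1_left mult_1_right)
  have "nonneg (star x * y * x)"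
    unfolding y_def using q t nonneg_one[where 'a = 'a]
    by (intro nonneg_conjugate nonneg_add nonneg_scaleR) auto
  then have "nonneg x" by (simp add: xy)
  then show ?thesis using that xy yx sx by (simp add: y_def)
qed

text \<open>
  Put \<open>p = b\<^sup>* b\<close>, \<open>q = c\<^sup>* c\<close>, \<open>y = q + t\<close>, and test the hypothesis on \<open>m = v\<close>, the inverse of the root of \<open>y\<close>.
  Since \<open>v q v \<le> v y v = 1\<close>, the norm of \<open>c v\<close> is at most \<open>1\<close>. So is that of \<open>b v\<close>, which
  means \<open>v p v \<le> 1\<close>. Conjugating by \<open>v y\<close>, the inverse of \<open>v\<close>, yields \<open>p \<le> y\<close>.
\<close>

lemma nonneg_diff_if_norm_mult_le:
  fixes b c :: "'a::{cstar_algebra,monoid_mult}"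
  assumes le: "\<And>m. norm (b * m) \<le> norm (c * m)"
  shows "nonneg (star c * c - star b * b)"
proof (rule nonneg_limit)
  fix t :: real assume t: "t > 0"
  define p q where "p = star b * b" and "q = star c * c"
  define y where "y = q + t *\<^sub>R 1"
  have q: "nonneg q" by (simp add: q_def nonneg_star_mult_self)
  obtain x where x: "nonneg x" "x * y = 1" "y * x = 1"
    using nonneg_resolvent[OF q t] unfolding y_def .
  obtain v where v: "nonneg v" "x = v * v" and comm: "\<forall>b. x * b = b * x \<longrightarrow> v * b = b * v"
    by (rule nonneg_sqrt[OF x(1)])
  have vy: "v * y = y * v" by (rule comm[rule_format]) (simp add: x)
  have sv: "star v = v" by (rule star_nonneg[OF v(1)])
  have "v * q * v = 1 - t *\<^sub>R x"
  proof -
    have "v * y * v = 1" using vy v(2) x(3) by (simp add: mult.assoc)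
    moreover have "v * y * v = v * q * v + t *\<^sub>R x"
      by (simp add: y_def v(2) algebra_simps)
    ultimately show ?thesis by (simp add: eq_diff_eq)
  qed
  then have "nonneg (1 - v * q * v)"
    using nonneg_scaleR[OF x(1)] t by simp
  moreover have "nonneg (v * q * v)" using nonneg_conjugate[OF q, of v] sv by simp
  ultimately have "norm (v * q * v) \<le> 1"
    using norm_mono norm_one_le order_trans by blast
  then have "(norm (c * v))\<^sup>2 \<le> 1"
    by (simp add: cstar_identity[symmetric] star_mult sv q_def mult.assoc)
  then have "(norm (b * v))\<^sup>2 \<le> 1"
    using le[of v] by (meson norm_ge_zero order_trans power_mono)
  then have "norm (v * p * v) \<le> 1"
    by (simp add: cstar_identity[symmetric] star_mult sv p_def mult.assoc)
  moreover have "star (v * p * v) = v * p * v" by (simp add: star_simps sv p_def mult.assoc)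
  ultimately have "nonneg (1 - v * p * v)"
    by (intro nonnegI[of _ 1]) (simp_all add: star_diff)
  then have "nonneg (star (v * y) * (1 - v * p * v) * (v * y))"
    by (rule nonneg_conjugate)
  moreover have "star (v * y) * (1 - v * p * v) * (v * y) = y - p"
  proof -
    have "star y = y" using star_nonneg[OF q] by (simp add: y_def star_simps)
    then have "star (v * y) * (1 - v * p * v) * (v * y) = y * x * y - (y * x) * p * (x * y)"
      by (simp add: star_mult sv v(2) algebra_simps)
    then show ?thesis using x by simp
  qed
  ultimately have "nonneg (y - p)" by (simp only:)
  then show "nonneg (star c * c - star b * b + t *\<^sub>R 1)"
    by (simp add: y_def p_def q_def algebra_simps)
qed

lemma star_mult_self_eq_if_norm_mult_eq_unital:
  fixes b c :: "'a::{cstar_algebra,monoid_mult}"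
  assumes "\<And>m. norm (b * m) = norm (c * m)"
  shows "star b * b = star c * c"
  using nonneg_antisym[of "star c * c - star b * b"]
    nonneg_diff_if_norm_mult_le[of b c] nonneg_diff_if_norm_mult_le[of c b] assms
  by simp

section \<open>The multiplier algebra\<close>

text \<open>
  Pairs \<open>(T, S)\<close> where \<open>S\<close> is an adjoint of \<open>T\<close> for the inner product \<open>star x * y\<close>. The second component is
  determined by the first, but carrying it along makes the involution a swap and completeness a
  matter of taking limits in both components.
\<close>

typedef (overloaded) 'a multiplier =
  "{(T :: 'a::cstar_algebra \<Rightarrow>\<^sub>L 'a, S :: 'a \<Rightarrow>\<^sub>L 'a). \<forall>x y. star (T x) * y = star x * S y}"
  morphisms pair_of_multiplier Multiplier
  by (rule exI[of _ "(0, 0)"]) simp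

definition act :: "'a::cstar_algebra multiplier \<Rightarrow> 'a \<Rightarrow>\<^sub>L 'a" where
  "act m = fst (pair_of_multiplier m)"

definition coact :: "'a::cstar_algebra multiplier \<Rightarrow> 'a \<Rightarrow>\<^sub>L 'a" where
  "coact m = snd (pair_of_multiplier m)"

lemma act_adjoint: "star (act m x) * y = star x * coact m y"
  using pair_of_multiplier[of m] by (auto simp: act_def coact_def)

lemma coact_adjoint: "star (coact m x) * y = star x * act m y"
  using arg_cong[OF act_adjoint[of m y x], of star] by (simp add: star_mult star_star)

lemma act_inject: "act m = act n \<longleftrightarrow> m = n"
proof
  assume eq: "act m = act n"
  have "coact m = coact n"
  proof (rule blinfun_eqI, rule eqI_star_mult)
    show "star z * coact m x = star z * coact n x" for x z
      using eq by (simp flip: act_adjoint)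
  qed
  with eq have "pair_of_multiplier m = pair_of_multiplier n"
    by (simp add: act_def coact_def prod_eq_iff)
  then show "m = n" by (simp add: pair_of_multiplier_inject)
qed simp

lemma multiplier_eqI: "(\<And>x. act m x = act n x) \<Longrightarrow> m = n"
  by (metis act_inject blinfun_eqI)

lemma Multiplier:
  fixes T S :: "'a::cstar_algebra \<Rightarrow>\<^sub>L 'a"
  assumes "\<And>x y. star (T x) * y = star x * S y"
  shows "act (Multiplier (T, S)) = T" "coact (Multiplier (T, S)) = S"
  using assms by (simp_all add: act_def coact_def Multiplier_inverse)

lemma act_scaleC: "act m (c *\<^sub>C x) = c *\<^sub>C act m x"
  by (rule eqI_star_mult) (simp add: mult_scaleC_right flip: coact_adjoint)

text \<open>
  The nontrivial half of the C*-identity, obtained as for operators on a Hilbert space from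
  \<open>(T x)\<^sup>* (T x) = x\<^sup>* (S T x)\<close>.
\<close>

lemma norm_act_square_le: "(norm (act m))\<^sup>2 \<le> norm (coact m o\<^sub>L act m)"
proof -
  let ?S = "coact m o\<^sub>L act m"
  have "norm (act m x) \<le> sqrt (norm ?S) * norm x" for x
  proof (rule power2_le_imp_le)
    have "(norm (act m x))\<^sup>2 = norm (star x * ?S x)"
      by (simp add: act_adjoint flip: cstar_identity)
    also have "\<dots> \<le> norm x * norm (?S x)"
      using norm_mult_ineq[of "star x" "?S x"] by (simp only: norm_star)
    also have "\<dots> \<le> norm x * (norm ?S * norm x)"
      by (intro mult_left_mono norm_blinfun norm_ge_zero)
    also have "\<dots> = (sqrt (norm ?S) * norm x)\<^sup>2"
      by (simp add: power_mult_distrib power2_eq_square[of "norm x"])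
    finally show "(norm (act m x))\<^sup>2 \<le> (sqrt (norm ?S) * norm x)\<^sup>2" .
  qed simp
  then have "norm (act m) \<le> sqrt (norm ?S)"
    by (intro norm_blinfun_bound) auto
  then show ?thesis
    by (metis norm_ge_zero power_mono real_sqrt_pow2)
qed

lemma norm_act_le_coact: "norm (act m) \<le> norm (coact m)"
proof -
  have "norm (act m) * norm (act m) \<le> norm (coact m) * norm (act m)"
    using norm_act_square_le[of m] norm_blinfun_compose[of "coact m" "act m"]
    by (simp add: power2_eq_square)
  then show ?thesis by (cases "norm (act m) = 0") auto
qed

lemma norm_coact_le_act: "norm (coact m) \<le> norm (act m)"
  using norm_act_le_coact[of "Multiplier (coact m, act m)"] coact_adjoint[of m]
  by (simp add: Multiplier)

lemma bounded_linear_scaleC: "bounded_linear (\<lambda>x::'a::cstar_algebra. c *\<^sub>C x)"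
proof (rule bounded_linear_intro[where K = "cmod c"])
  show "c *\<^sub>C (r *\<^sub>R x) = r *\<^sub>R (c *\<^sub>C x)" for r and x :: 'a
    unfolding scaleC_of_real[symmetric] scaleC_scaleC by (simp add: mult.commute)
qed (simp_all add: scaleC_add_right norm_scaleC mult.commute)

definition blinfun_scaleC :: "complex \<Rightarrow> 'a::cstar_algebra \<Rightarrow>\<^sub>L 'a" where
  "blinfun_scaleC c = Blinfun (\<lambda>x. c *\<^sub>C x)"

lemma blinfun_scaleC_apply [simp]: "blinfun_scaleC c x = c *\<^sub>C x"
  by (simp add: blinfun_scaleC_def bounded_linear_Blinfun_apply bounded_linear_scaleC)

instantiation multiplier :: (cstar_algebra) real_normed_vector
begin

definition "0 = Multiplier (0 :: 'a \<Rightarrow>\<^sub>L 'a, 0 :: 'a \<Rightarrow>\<^sub>L 'a)"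
definition "m + n = Multiplier (act m + act n, coact m + coact n)" for m n :: "'a multiplier"
definition "m - n = Multiplier (act m - act n, coact m - coact n)" for m n :: "'a multiplier"
definition "- m = Multiplier (- act m, - coact m)" for m :: "'a multiplier"
definition "r *\<^sub>R m = Multiplier (r *\<^sub>R act m, r *\<^sub>R coact m)" for m :: "'a multiplier"
definition "norm m = norm (act m)" for m :: "'a multiplier"
definition "dist m n = norm (m - n)" for m n :: "'a multiplier"
definition "sgn m = inverse (norm m) *\<^sub>R m" for m :: "'a multiplier"
definition "uniformity = (INF e\<in>{0<..}. principal {(m, n :: 'a multiplier). dist m n < e})"
definition "open U = (\<forall>m\<in>U. \<forall>\<^sub>F (m', n) in uniformity. m' = m \<longrightarrow> n \<in> U)" for U :: "'a multiplier set"

lemma act_real_vector: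
  "act 0 = (0 :: 'a \<Rightarrow>\<^sub>L 'a)" "act (m + n) = act m + act n" "act (m - n) = act m - act n"
  "act (- m) = - act m" "act (r *\<^sub>R m) = r *\<^sub>R act m"
  and coact_real_vector:
  "coact 0 = (0 :: 'a \<Rightarrow>\<^sub>L 'a)" "coact (m + n) = coact m + coact n" "coact (m - n) = coact m - coact n"
  "coact (- m) = - coact m" "coact (r *\<^sub>R m) = r *\<^sub>R coact m"
  for m n :: "'a multiplier"
proof -
  show "act 0 = (0 :: 'a \<Rightarrow>\<^sub>L 'a)" "coact 0 = (0 :: 'a \<Rightarrow>\<^sub>L 'a)"
    unfolding zero_multiplier_def by (rule Multiplier, simp add: star_simps)+
  show "act (m + n) = act m + act n" "coact (m + n) = coact m + coact n"
    unfolding plus_multiplier_def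
    by (rule Multiplier, simp add: blinfun.add_left star_add distrib_left distrib_right act_adjoint)+
  show "act (m - n) = act m - act n" "coact (m - n) = coact m - coact n"
    unfolding minus_multiplier_def
    by (rule Multiplier, simp add: blinfun.diff_left star_diff left_diff_distrib right_diff_distrib act_adjoint)+
  show "act (- m) = - act m" "coact (- m) = - coact m"
    unfolding uminus_multiplier_def
    by (rule Multiplier, simp add: blinfun.minus_left star_minus act_adjoint)+
  show "act (r *\<^sub>R m) = r *\<^sub>R act m" "coact (r *\<^sub>R m) = r *\<^sub>R coact m"
    unfolding scaleR_multiplier_def
    by (rule Multiplier, simp add: blinfun.scaleR_left star_scaleR act_adjoint)+
qed

instance
proof
  fix m n k :: "'a multiplier" and r q :: real
  show "dist m n = norm (m - n)" "sgn m = inverse (norm m) *\<^sub>R m"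
    by (rule dist_multiplier_def, rule sgn_multiplier_def)
  show "norm (m + n) \<le> norm m + norm n" "norm (r *\<^sub>R m) = \<bar>r\<bar> * norm m"
    by (simp_all add: norm_multiplier_def act_real_vector norm_triangle_ineq)
  show "norm m = 0 \<longleftrightarrow> m = 0"
    by (simp add: norm_multiplier_def act_real_vector flip: act_inject)
  show "m + n + k = m + (n + k)" "m + n = n + m" "0 + m = m" "- m + m = 0" "m - n = m + - n"
    "r *\<^sub>R (m + n) = r *\<^sub>R m + r *\<^sub>R n" "(r + q) *\<^sub>R m = r *\<^sub>R m + q *\<^sub>R m"
    "r *\<^sub>R q *\<^sub>R m = (r * q) *\<^sub>R m" "1 *\<^sub>R m = m"
    unfolding act_inject[symmetric] act_real_vector by (simp_all add: algebra_simps)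
qed (rule uniformity_multiplier_def, rule open_multiplier_def)

end

instance multiplier :: (cstar_algebra) banach
proof
  fix X :: "nat \<Rightarrow> 'a multiplier"
  assume X: "Cauchy X"
  have dist_act: "dist (act m) (act n) = dist m n" for m n :: "'a multiplier"
    by (simp add: dist_norm norm_multiplier_def act_real_vector)
  have dist_coact: "dist (coact m) (coact n) \<le> dist m n" for m n :: "'a multiplier"
    using norm_coact_le_act[of "m - n"]
    by (simp add: dist_norm norm_multiplier_def act_real_vector coact_real_vector)
  have "Cauchy (\<lambda>n. act (X n))"
    using X by (simp add: Cauchy_def dist_act)
  moreover have "Cauchy (\<lambda>n. coact (X n))"
    using X unfolding Cauchy_def by (meson dist_coact le_less_trans)
  ultimately obtain T S where T: "(\<lambda>n. act (X n)) \<longlonglongrightarrow> T" and S: "(\<lambda>n. coact (X n)) \<longlonglongrightarrow> S"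
    by (meson Cauchy_convergent convergent_def)
  have "star (T x) * y = star x * S y" for x y
  proof (rule LIMSEQ_unique)
    show "(\<lambda>n. star (act (X n) x) * y) \<longlonglongrightarrow> star (T x) * y"
      by (intro tendsto_intros bounded_linear.tendsto[OF bounded_linear_star] T)
    show "(\<lambda>n. star (act (X n) x) * y) \<longlonglongrightarrow> star x * S y"
      unfolding act_adjoint by (intro tendsto_intros S)
  qed
  then have "act (Multiplier (T, S)) = T" by (rule Multiplier)
  then have "dist (X n) (Multiplier (T, S)) = dist (act (X n)) T" for n
    by (metis dist_act)
  then have "X \<longlonglongrightarrow> Multiplier (T, S)"
    using T by (simp add: tendsto_dist_iff[of X] tendsto_dist_iff[of "\<lambda>n. act (X n)"])
  then show "convergent X" by (auto simp: convergent_def)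
qed

instantiation multiplier :: (cstar_algebra) "{cstar_algebra, monoid_mult}"
begin

definition "1 = Multiplier (id_blinfun :: 'a \<Rightarrow>\<^sub>L 'a, id_blinfun :: 'a \<Rightarrow>\<^sub>L 'a)"
definition "m * n = Multiplier (act m o\<^sub>L act n, coact n o\<^sub>L coact m)" for m n :: "'a multiplier"
definition "c *\<^sub>C m = Multiplier (blinfun_scaleC c o\<^sub>L act m, blinfun_scaleC (cnj c) o\<^sub>L coact m)"
  for m :: "'a multiplier"
definition "star m = Multiplier (coact m, act m)" for m :: "'a multiplier"

lemma act_algebra:
  "act 1 = (id_blinfun :: 'a \<Rightarrow>\<^sub>L 'a)" "act (m * n) = act m o\<^sub>L act n"
  "act (c *\<^sub>C m) = blinfun_scaleC c o\<^sub>L act m" "act (star m) = coact m"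
  and coact_algebra:
  "coact 1 = (id_blinfun :: 'a \<Rightarrow>\<^sub>L 'a)" "coact (m * n) = coact n o\<^sub>L coact m"
  "coact (c *\<^sub>C m) = blinfun_scaleC (cnj c) o\<^sub>L coact m" "coact (star m) = act m"
  for m n :: "'a multiplier"
proof -
  show "act 1 = (id_blinfun :: 'a \<Rightarrow>\<^sub>L 'a)" "coact 1 = (id_blinfun :: 'a \<Rightarrow>\<^sub>L 'a)"
    by (simp_all add: one_multiplier_def Multiplier)
  show "act (m * n) = act m o\<^sub>L act n" "coact (m * n) = coact n o\<^sub>L coact m"
    by (simp_all add: times_multiplier_def Multiplier act_adjoint)
  show "act (star m) = coact m" "coact (star m) = act m"
    by (simp_all add: star_multiplier_def Multiplier coact_adjoint)
  show "act (c *\<^sub>C m) = blinfun_scaleC c o\<^sub>L act m"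
    "coact (c *\<^sub>C m) = blinfun_scaleC (cnj c) o\<^sub>L coact m"
    by (simp_all add: scaleC_multiplier_def Multiplier act_adjoint star_scaleC mult_scaleC_left mult_scaleC_right)
qed

instance
proof
  fix m n k :: "'a multiplier" and c d :: complex and r :: real
  note simps = act_algebra coact_algebra act_real_vector coact_real_vector blinfun.bilinear_simps
  show "m * n * k = m * (n * k)" "1 * m = m" "m * 1 = m" "star (star m) = m" "star (m * n) = star n * star m"
    by (rule multiplier_eqI, simp only: simps blinfun_apply_blinfun_compose blinfun_apply_id_blinfun)+
  show "(m + n) * k = m * k + n * k" "m * (n + k) = m * n + m * k"
    "r *\<^sub>R m * n = r *\<^sub>R (m * n)" "m * r *\<^sub>R n = r *\<^sub>R (m * n)" "star (m + n) = star m + star n"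
    by (rule multiplier_eqI, simp only: simps blinfun_apply_blinfun_compose)+
  show "complex_of_real r *\<^sub>C m = r *\<^sub>R m" "c *\<^sub>C (m + n) = c *\<^sub>C m + c *\<^sub>C n"
    "(c + d) *\<^sub>C m = c *\<^sub>C m + d *\<^sub>C m" "c *\<^sub>C d *\<^sub>C m = (c * d) *\<^sub>C m"
    "(c *\<^sub>C m) * n = c *\<^sub>C (m * n)" "m * (c *\<^sub>C n) = c *\<^sub>C (m * n)"
    "star (c *\<^sub>C m) = cnj c *\<^sub>C star m"
    by (rule multiplier_eqI, simp only: simps blinfun_apply_blinfun_compose blinfun_scaleC_apply
      scaleC_of_real scaleC_add_left scaleC_add_right scaleC_scaleC act_scaleC)+
  show mult: "norm (m * n) \<le> norm m * norm n" for m n :: "'a multiplier"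
    by (simp add: norm_multiplier_def act_algebra norm_blinfun_compose)
  show "norm (c *\<^sub>C m) = cmod c * norm m"
  proof (rule antisym)
    have "norm (blinfun_scaleC c :: 'a \<Rightarrow>\<^sub>L 'a) \<le> cmod c"
      by (rule norm_blinfun_bound) (simp_all add: norm_scaleC)
    then show "norm (c *\<^sub>C m) \<le> cmod c * norm m"
      unfolding norm_multiplier_def act_algebra
      by (meson mult_right_mono norm_blinfun_compose norm_ge_zero order_trans)
    show "cmod c * norm m \<le> norm (c *\<^sub>C m)"
    proof (cases "c = 0")
      case False
      have "norm (act m) \<le> norm (act (c *\<^sub>C m)) / cmod c"
      proof (rule norm_blinfun_bound)
        show "norm (act m x) \<le> norm (act (c *\<^sub>C m)) / cmod c * norm x" for x
          using norm_blinfun[of "act (c *\<^sub>C m)" x] False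
          by (simp add: act_algebra norm_scaleC field_simps)
      qed simp
      then show ?thesis using False by (simp add: norm_multiplier_def field_simps)
    qed simp
  qed
  \<comment> \<open>The reverse inequality is submultiplicativity, because an operator and its adjoint have equal norm.\<close>
  show "norm (star m * m) = (norm m)\<^sup>2"
  proof (rule antisym)
    have "norm (star m * m) \<le> norm (star m) * norm m" by (rule mult)
    also have "norm (star m) = norm m"
      unfolding norm_multiplier_def act_algebra
      by (intro antisym norm_coact_le_act norm_act_le_coact)
    finally show "norm (star m * m) \<le> (norm m)\<^sup>2" by (simp add: power2_eq_square)
    show "(norm m)\<^sup>2 \<le> norm (star m * m)"
      using norm_act_square_le[of m] by (simp add: norm_multiplier_def act_algebra)
  qed
qed
end

section \<open>Consequences for arbitrary C*-algebras\<close>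

definition left_mult :: "'a::cstar_algebra \<Rightarrow> 'a multiplier" where
  "left_mult a = Multiplier (blinfun_mult_right a, blinfun_mult_right (star a))"

lemma act_left_mult: "act (left_mult a) = blinfun_mult_right a"
  and coact_left_mult: "coact (left_mult a) = blinfun_mult_right (star a)"
  unfolding left_mult_def by (rule Multiplier, simp add: star_mult mult.assoc)+

lemma left_mult_add: "left_mult (a + b) = left_mult a + left_mult b"
  and left_mult_diff: "left_mult (a - b) = left_mult a - left_mult b"
  and left_mult_mult: "left_mult (a * b) = left_mult a * left_mult b"
  by (auto intro!: multiplier_eqI simp: act_left_mult act_real_vector act_algebra blinfun.add_left
      blinfun.diff_left distrib_right left_diff_distrib mult.assoc)

lemma left_mult_star: "left_mult (star a) = star (left_mult a)"
  by (simp add: act_left_mult coact_left_mult act_algebra flip: act_inject)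

lemma norm_left_mult: "norm (left_mult a) = norm a"
proof (rule antisym)
  show "norm (left_mult a) \<le> norm a"
    unfolding norm_multiplier_def act_left_mult
    by (rule norm_blinfun_bound) (simp_all add: norm_mult_ineq)
  have "norm (star a) * norm (star a) \<le> norm (left_mult a) * norm a"
    using norm_blinfun[of "act (left_mult a)" "star a"] cstar_identity[of "star a"]
    by (simp add: act_left_mult norm_multiplier_def star_star power2_eq_square)
  then show "norm a \<le> norm (left_mult a)"
    by (cases "norm a = 0") auto
qed

lemma left_mult_inject: "left_mult a = left_mult b \<longleftrightarrow> a = b"
  using norm_left_mult[of "a - b"] by (auto simp: left_mult_diff)

text \<open>
  The hypothesis extends from the algebra to its multipliers, since the norm of \<open>left_mult b * m\<close> is the
  supremum of \<open>norm (b * act m x) / norm x\<close>.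
\<close>

lemma star_mult_self_eq_if_norm_mult_eq:
  fixes b c :: "'a::cstar_algebra"
  assumes eq: "\<And>a. norm (b * a) = norm (c * a)"
  shows "star b * b = star c * c"
proof -
  have "norm (left_mult b * m) = norm (left_mult c * m)" for m
    by (simp add: norm_multiplier_def norm_blinfun.rep_eq onorm_def act_algebra act_left_mult eq)
  then have "star (left_mult b) * left_mult b = star (left_mult c) * left_mult c"
    by (rule star_mult_self_eq_if_norm_mult_eq_unital)
  then show ?thesis
    by (simp add: left_mult_inject flip: left_mult_star left_mult_mult)
qed

text \<open>
  Unlike \<open>norm_commuting_le\<close> this compares elements that need not commute, so it rests on the
  positivity of \<open>star b * b\<close>.
\<close>

lemma norm_le_norm_sum_squares:
  fixes a b :: "'a::cstar_algebra"
  shows "(norm a)\<^sup>2 \<le> norm (star a * a + star b * b)"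
proof -
  have "norm (star (left_mult a) * left_mult a)
      \<le> norm (star (left_mult a) * left_mult a + star (left_mult b) * left_mult b)"
    by (rule norm_mono) (simp_all add: nonneg_star_mult_self)
  then show ?thesis
    by (simp add: norm_left_mult cstar_identity flip: left_mult_star left_mult_mult left_mult_add)
qed

text \<open>
  If \<open>h\<close> is selfadjoint and \<open>norm h \<le> 1\<close>, then \<open>h\<^sup>2 + (1 - k)\<^sup>2 = 1\<close> for some selfadjoint \<open>k\<close> in the
  algebra that commutes with \<open>h\<close>. This algebraic relation survives \<open>\<gamma>\<close>, and among the multipliers
  of the target it bounds the norm of \<open>\<gamma> h\<close> by \<open>1\<close>. The C*-identity reduces general elements to
  selfadjoint ones.
\<close>

lemma star_isomorphism_norm_le:
  fixes \<gamma> :: "'a::cstar_algebra \<Rightarrow> 'b::cstar_algebra"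
  assumes \<gamma>: "star_isomorphism \<gamma>"
  shows "norm (\<gamma> a) \<le> norm a"
proof -
  interpret lin: Vector_Spaces.linear scaleC scaleC \<gamma>
    using \<gamma> by (simp add: star_isomorphism_def)
  have mult: "\<gamma> (x * y) = \<gamma> x * \<gamma> y" and star: "\<gamma> (star x) = star (\<gamma> x)" for x y
    using \<gamma> by (auto simp: star_isomorphism_def)
  have scaleR: "\<gamma> (r *\<^sub>R x) = r *\<^sub>R \<gamma> x" for r x
    using lin.scale[of "complex_of_real r" x] by (simp add: scaleC_of_real)
  have unit: "norm (\<gamma> h) \<le> 1" if h: "star h = h" "norm h \<le> 1" for h
  proof -
    have "norm (h * h) \<le> 1"
      using h by (simp add: norm_square_selfadjoint power_le_one)
    moreover have "star (h * h) = h * h" by (simp add: star_mult h)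
    ultimately obtain k where k: "k + k = h * h + k * k" "star k = k"
      and comm: "\<And>b. h * h * b = b * (h * h) \<Longrightarrow> k * b = b * k"
      using cstar_sqrt by metis
    have kh: "k * h = h * k" by (rule comm) (simp add: mult.assoc)
    define s r where "s = left_mult (\<gamma> h)" and "r = 1 - left_mult (\<gamma> k)"
    have "star s = s" "star r = r"
      by (simp_all add: s_def r_def star_diff h k flip: left_mult_star star)
    moreover have "s * r = r * s"
      by (simp add: s_def r_def left_diff_distrib right_diff_distrib kh flip: left_mult_mult mult)
    ultimately have "(norm s)\<^sup>2 \<le> norm (s * s + r * r)"
      by (rule norm_commuting_le)
    also have "s * s + r * r = 1 + left_mult (\<gamma> (h * h + k * k - (k + k)))"
      by (simp add: s_def r_def algebra_simps left_mult_add left_mult_diff left_mult_mult mult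
          lin.add lin.diff)
    also have "\<dots> = 1"
      by (simp add: k(1) lin.zero left_mult_diff[of 0 0, simplified])
    finally have "(norm s)\<^sup>2 \<le> 1" using norm_one_le order_trans by blast
    then show ?thesis by (simp add: s_def norm_left_mult power_le_one_iff)
  qed
  have sa: "norm (\<gamma> h) \<le> norm h" if h: "star h = h" for h
  proof (cases "h = 0")
    case False
    then have "norm (\<gamma> ((1 / norm h) *\<^sub>R h)) \<le> 1"
      by (intro unit) (auto simp: star_scaleR h)
    then show ?thesis using False by (simp add: scaleR divide_simps)
  qed (simp add: lin.zero)
  have "(norm (\<gamma> a))\<^sup>2 = norm (\<gamma> (star a * a))" by (simp add: mult star cstar_identity)
  also have "\<dots> \<le> norm (star a * a)" by (intro sa) (simp add: star_simps)
  finally have "(norm (\<gamma> a))\<^sup>2 \<le> (norm a)\<^sup>2" by (simp add: cstar_identity)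
  then show ?thesis by (rule power2_le_imp_le) simp
qed

lemma star_isomorphism_inv:
  assumes \<gamma>: "star_isomorphism \<gamma>"
  shows "star_isomorphism (inv \<gamma>)"
proof -
  interpret lin: Vector_Spaces.linear scaleC scaleC \<gamma>
    using \<gamma> by (simp add: star_isomorphism_def)
  have bij: "bij \<gamma>" and mult: "\<gamma> (x * y) = \<gamma> x * \<gamma> y" and star: "\<gamma> (star x) = star (\<gamma> x)" for x y
    using \<gamma> by (auto simp: star_isomorphism_def)
  have inv: "\<gamma> (inv \<gamma> y) = y" for y using bij by (simp add: bij_is_surj surj_f_inv_f)
  have eqI: "inv \<gamma> y = x" if "\<gamma> x = y" for x y using bij that by (auto simp: bij_is_inj)
  have "Vector_Spaces.linear scaleC scaleC (inv \<gamma>)"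
    unfolding Vector_Spaces.linear_iff
    by (auto intro!: eqI vector_space_scaleC simp: lin.add lin.scale inv)
  then show ?thesis
    unfolding star_isomorphism_def by (auto intro!: eqI bij_imp_bij_inv bij simp: mult star inv)
qed

lemma star_isomorphism_norm:
  assumes "star_isomorphism \<gamma>"
  shows "norm (\<gamma> a) = norm a"
proof (rule antisym)
  have "inv \<gamma> (\<gamma> a) = a"
    using assms by (simp add: star_isomorphism_def bij_is_inj)
  then show "norm a \<le> norm (\<gamma> a)"
    using star_isomorphism_norm_le[OF star_isomorphism_inv[OF assms], of "\<gamma> a"] by simp
qed (rule star_isomorphism_norm_le[OF assms])

section \<open>Isometries of Hilbert modules\<close>

context hilbert_module
begin

lemma hnorm_ract:
  assumes "ip E x x = star b * b"
  shows "hnorm E (ract E x a) = norm (b * a)"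
  using cstar_identity[of "b * a"]
  by (simp add: hnorm_def ip_ract_left ip_ract_right assms star_mult mult.assoc)

text \<open>
  On \<open>(a, y)\<close> the corner of \<open>x\<close> only sees \<open>a\<close>. With \<open>ip E x x = star b * b\<close> its norm is therefore the
  supremum of \<open>norm (b * a)\<close>, which normalizing \<open>star b\<close> attains.
\<close>

lemma module_matrix_norm_one: "module_matrix_norm E (Suc 0) (\<lambda>i j. x) = hnorm E x"
proof -
  obtain b where b: "ip E x x = star b * b" using ip_positive by blast
  have hx: "hnorm E x = norm b" by (simp add: hnorm_def b cstar_identity)
  have apply_corner: "tuple_norm (sum_module E) (Suc 0) (\<lambda>i. \<Sum>j<Suc 0. corner E x (\<xi> j))
      = norm (b * fst (\<xi> 0))" for \<xi> :: "nat \<Rightarrow> 'a \<times> 'x"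
    using hnorm_ract[OF b, of "fst (\<xi> 0)"]
    by (cases "\<xi> 0") (simp add: tuple_norm_def sum_module_def corner_def linking_op_def hnorm_def)
  have "(SUP \<xi>\<in>{\<xi>. tuple_norm (sum_module E) (Suc 0) \<xi> \<le> 1}. norm (b * fst (\<xi> 0))) = norm b"
  proof (rule cSup_eq_maximum)
    \<comment> \<open>For \<open>b = 0\<close> this is \<open>0\<close>, which still attains the supremum.\<close>
    define a where "a = (1 / norm b) *\<^sub>R star b"
    have "norm (b * a) = norm b"
      using cstar_identity[of "star b"] by (simp add: a_def star_star power2_eq_square)
    moreover have "tuple_norm (sum_module E) (Suc 0) (\<lambda>i. (a, 0)) \<le> 1"
      by (simp add: tuple_norm_def sum_module_def cstar_identity) (simp add: a_def)
    ultimately show "norm b \<in> (\<lambda>\<xi>. norm (b * fst (\<xi> 0))) ` {\<xi>. tuple_norm (sum_module E) (Suc 0) \<xi> \<le> 1}"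
      by (intro image_eqI[of _ _ "\<lambda>i. (a, 0)"]) auto
  next
    fix r assume "r \<in> (\<lambda>\<xi>. norm (b * fst (\<xi> 0))) ` {\<xi>. tuple_norm (sum_module E) (Suc 0) \<xi> \<le> 1}"
    then obtain \<xi> where \<xi>: "tuple_norm (sum_module E) (Suc 0) \<xi> \<le> 1" and r: "r = norm (b * fst (\<xi> 0))"
      by auto
    obtain a y where ay: "\<xi> 0 = (a, y)" by fastforce
    obtain c where "ip E y y = star c * c" using ip_positive by blast
    with \<xi> ay have "norm (star a * a + star c * c) \<le> 1"
      by (simp add: tuple_norm_def sum_module_def)
    then have "(norm a)\<^sup>2 \<le> 1" using norm_le_norm_sum_squares order_trans by blast
    then have "norm a \<le> 1" by (simp add: power_le_one_iff)
    then have "norm b * norm a \<le> norm b" by (simp add: mult_left_le)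
    then show "r \<le> norm b" using norm_mult_ineq[of b a] r ay by simp
  qed
  then show ?thesis
    unfolding module_matrix_norm_def op_matrix_norm_def apply_corner hx .
qed

lemma ip_hscale_left: "ip E (hscale E c x) y = cnj c *\<^sub>C ip E x y"
  by (metis ip_hscale_right star_ip star_scaleC)

end

text \<open>
  Polarization: a sesquilinear form \<open>D\<close> that vanishes on the diagonal is skew, and replacing \<open>y\<close> by \<open>\<i> y\<close>
  in \<open>D x y + D y x = 0\<close> makes it symmetric too.
\<close>

lemma ip_eq_if_diagonal_eq:
  assumes X: "hilbert_module X" and Y: "hilbert_module Y" and \<gamma>: "Vector_Spaces.linear scaleC scaleC \<gamma>"
    and u: "Vector_Spaces.linear (hscale X) (hscale Y) u"
    and diag: "\<And>x. ip Y (u x) (u x) = \<gamma> (ip X x x)"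
  shows "ip Y (u x) (u y) = \<gamma> (ip X x y)"
proof -
  interpret X: hilbert_module X by fact
  interpret Y: hilbert_module Y by fact
  interpret \<gamma>: Vector_Spaces.linear scaleC scaleC \<gamma> by fact
  interpret u: Vector_Spaces.linear "hscale X" "hscale Y" u by fact
  define D where "D x y = ip Y (u x) (u y) - \<gamma> (ip X x y)" for x y
  have skew: "D x y + D y x = 0" for x y
    using diag[of "x + y"] diag[of x] diag[of y]
    by (simp add: D_def u.add \<gamma>.add X.ip_add_left X.ip_add_right Y.ip_add_left Y.ip_add_right
        algebra_simps)
  have right: "D x (hscale X \<i> y) = \<i> *\<^sub>C D x y" for x y
    by (simp add: D_def u.scale \<gamma>.scale X.ip_hscale_right Y.ip_hscale_right scaleC_diff_right)
  have left: "D (hscale X \<i> y) x = - (\<i> *\<^sub>C D y x)" for x y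
    using scaleC_scaleC[of "-1" \<i>]
    by (simp add: D_def u.scale \<gamma>.scale X.ip_hscale_left Y.ip_hscale_left scaleC_diff_right
        scaleC_minus_one \<gamma>.neg)
  have "\<i> *\<^sub>C (D x y - D y x) = 0"
    using skew[of x "hscale X \<i> y"] by (simp add: right left scaleC_diff_right)
  then have "(- \<i>) *\<^sub>C \<i> *\<^sub>C (D x y - D y x) = 0" by simp
  then have "D x y - D y x = 0" by (simp add: scaleC_scaleC)
  with skew[of x y] have "D x y + D x y = 0" by simp
  then have "2 *\<^sub>R D x y = 0" by (simp add: scaleR_2)
  then show ?thesis by (simp add: D_def)
qed

text \<open>
  Applying the isometry to \<open>x a\<close> for all \<open>a\<close>, and not just to \<open>x\<close>, gives enough norms to recover
  \<open>ip Y (u x) (u x)\<close>.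
\<close>

lemma ip_preserving_if_completely_isometric:
  assumes X: "hilbert_module X" and Y: "hilbert_module Y"
    and \<gamma>: "star_isomorphism \<gamma>" and u: "Vector_Spaces.linear (hscale X) (hscale Y) u"
    and ci: "complete_isometry X Y u" and ract: "\<And>x a. u (ract X x a) = ract Y (u x) (\<gamma> a)"
  shows "ip Y (u x) (u y) = \<gamma> (ip X x y)"
proof (rule ip_eq_if_diagonal_eq[OF X Y _ u])
  interpret X: hilbert_module X by fact
  interpret Y: hilbert_module Y by fact
  show "Vector_Spaces.linear scaleC scaleC \<gamma>" using \<gamma> by (simp add: star_isomorphism_def)
  have mult: "\<gamma> (x * y) = \<gamma> x * \<gamma> y" and star: "\<gamma> (star x) = star (\<gamma> x)" and surj: "surj \<gamma>" for x y
    using \<gamma> by (auto simp: star_isomorphism_def bij_is_surj)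
  have iso: "hnorm Y (u x) = hnorm X x" for x
    using ci by (simp add: complete_isometry_def flip: X.module_matrix_norm_one Y.module_matrix_norm_one)
  show "ip Y (u x) (u x) = \<gamma> (ip X x x)" for x
  proof -
    obtain b where b: "ip X x x = star b * b" using X.ip_positive by blast
    obtain c where c: "ip Y (u x) (u x) = star c * c" using Y.ip_positive by blast
    have "star c * c = star (\<gamma> b) * \<gamma> b"
    proof (rule star_mult_self_eq_if_norm_mult_eq)
      fix d
      obtain a where a: "d = \<gamma> a" using surj by blast
      have "norm (c * d) = hnorm Y (u (ract X x a))"
        by (simp add: Y.hnorm_ract[OF c] ract a)
      also have "\<dots> = norm (\<gamma> (b * a))"
        by (simp add: iso X.hnorm_ract[OF b] star_isomorphism_norm[OF \<gamma>])
      finally show "norm (c * d) = norm (\<gamma> b * d)" by (simp add: mult a)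
    qed
    then show ?thesis by (simp add: b c mult star)
  qed
qed

text \<open>
  The map \<open>U = (\<gamma>, u)\<close> is a bijection of the sum modules that is unitary up to \<open>\<gamma>\<close> and intertwines the
  corners. Applied entrywise it identifies the unit balls over which the two suprema range.
\<close>

lemma completely_isometric_if_ip_preserving:
  assumes X: "hilbert_module X" and Y: "hilbert_module Y"
    and \<gamma>: "star_isomorphism \<gamma>" and u: "Vector_Spaces.linear (hscale X) (hscale Y) u" and surj: "surj u"
    and ip: "\<And>x y. ip Y (u x) (u y) = \<gamma> (ip X x y)"
    and ract: "\<And>x a. u (ract X x a) = ract Y (u x) (\<gamma> a)"
  shows "complete_isometry X Y u"
  unfolding complete_isometry_def
proof (intro allI)
  fix n :: nat and x :: "nat \<Rightarrow> nat \<Rightarrow> _"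
  interpret lin: Vector_Spaces.linear scaleC scaleC \<gamma>
    using \<gamma> by (simp add: star_isomorphism_def)
  interpret u: Vector_Spaces.linear "hscale X" "hscale Y" u by fact
  have mult: "\<gamma> (x * y) = \<gamma> x * \<gamma> y" and star: "\<gamma> (star x) = star (\<gamma> x)" and surj\<gamma>: "surj \<gamma>" for x y
    using \<gamma> by (auto simp: star_isomorphism_def bij_is_surj)
  define U where "U = map_prod \<gamma> u"
  have "surj U" unfolding U_def using surj\<gamma> surj by (rule map_prod_surj)
  then have U_inv: "U (inv U \<eta>) = \<eta>" for \<eta> by (rule surj_f_inv_f)
  have U_sum: "U (\<Sum>i\<in>I. f i) = (\<Sum>i\<in>I. U (f i))" for f and I :: "nat set"
    by (simp add: U_def prod_eq_iff fst_sum snd_sum lin.sum u.sum)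
  have U_ip: "ip (sum_module Y) (U \<xi>) (U \<eta>) = \<gamma> (ip (sum_module X) \<xi> \<eta>)" for \<xi> \<eta>
    by (cases \<xi>; cases \<eta>) (simp add: U_def sum_module_def ip mult star lin.add)
  have U_norm: "tuple_norm (sum_module Y) n (\<lambda>i. U (\<xi> i)) = tuple_norm (sum_module X) n \<xi>" for \<xi>
    by (simp add: tuple_norm_def U_ip star_isomorphism_norm[OF \<gamma>] flip: lin.sum)
  have U_corner: "corner Y (u x) (U \<xi>) = U (corner X x \<xi>)" for x \<xi>
    by (cases \<xi>) (simp add: U_def corner_def linking_op_def ract lin.zero)
  have "{\<eta>. tuple_norm (sum_module Y) n \<eta> \<le> 1} = (\<lambda>\<xi> i. U (\<xi> i)) ` {\<xi>. tuple_norm (sum_module X) n \<xi> \<le> 1}"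
  proof (intro set_eqI iffI)
    fix \<eta> assume \<eta>: "\<eta> \<in> {\<eta>. tuple_norm (sum_module Y) n \<eta> \<le> 1}"
    then show "\<eta> \<in> (\<lambda>\<xi> i. U (\<xi> i)) ` {\<xi>. tuple_norm (sum_module X) n \<xi> \<le> 1}"
      using U_norm[of "\<lambda>i. inv U (\<eta> i)"]
      by (intro image_eqI[of _ _ "\<lambda>i. inv U (\<eta> i)"]) (auto simp: U_inv)
  qed (auto simp: U_norm)
  then show "module_matrix_norm Y n (\<lambda>i j. u (x i j)) = module_matrix_norm X n x"
    unfolding module_matrix_norm_def op_matrix_norm_def
    by (simp only: image_image U_corner U_norm flip: U_sum)
qed

theorem proposition3p1:
  fixes X :: "('a::cstar_algebra, 'x::ab_group_add) corr"
    and Y :: "('b::cstar_algebra, 'y::ab_group_add) corr"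
  assumes "cstar_correspondence X" and "cstar_correspondence Y"
  shows "completely_isometrically_isomorphic X Y \<longleftrightarrow> unitarily_equivalent X Y"
proof -
  have X: "hilbert_module X" and Y: "hilbert_module Y"
    using assms by (simp_all add: cstar_correspondence_def)
  show ?thesis
    unfolding completely_isometrically_isomorphic_def unitarily_equivalent_def bimodule_map_def
    using ip_preserving_if_completely_isometric[OF X Y] completely_isometric_if_ip_preserving[OF X Y]
    by blast
qed

end
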